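(* Let $f^1:\tilde X\to X^1$ and $f^2:\tilde X\to X^2$ be coverings of graphs of objects (with respect to a fixed triple $(\mathcal{C},\mathcal{M}_1,\mathcal{M}_2)$), with underlying graphs $G_1:=G_{X^1}$ and $G_2:=G_{X^2}$ both finite, and $T:=G_{\tilde X}$ a tree. Let $\Gamma_1$ and $\Gamma_2$ be the groups of deck transformations for $f^1$ and $f^2$, and suppose that $\Gamma_1,\Gamma_2\leqslant H\leqslant\operatorname{Aut}(\tilde X)$. Suppose also that $H$ has finite edge isotropy groups. Then $X^1$ and $X^2$ have a common finite cover $X$, and there exists $g\in\mathscr{S}(H)$ that fits into a commutative diagram of coverings; that is, there are a finite graph of objects $X$, coverings $\mu^1:X\to X^1$, $\mu^2:X\to X^2$, $\nu^1:\tilde X\to X$, $\nu^2:\tilde X\to X$, and $g\in\mathscr{S}(H)$ such that $$f^1=\mu^1\nu^1,\qquad f^2=\mu^2\nu^2,\qquad \nu^1=\nu^2 g.$$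
   Context: Graphs. A graph $G$ consists of a vertex set $V(G)$, an edge set $E(G)$ (of oriented edges), maps $\partial_0,\partial_1:E(G)\to V(G)$ (initial and terminal vertex), and an involution $e\mapsto\overline{e}$ on $E(G)$ with $e\neq\overline{e}$, $\partial_0 e=\partial_1\overline{e}$ and $\partial_0\overline{e}=\partial_1 e$. Graph morphisms preserve $\partial_0,\partial_1$ and edge inversion; automorphisms are morphisms from a graph to itself bijective on vertices and edges. For $v\in V(G)$, $\mathrm{star}(v)=\{e\in E(G)\mid\partial_0e=v\}$. A graph morphism $\alpha:G_1\to G_2$ is a covering if it is surjective and the induced maps $\mathrm{star}(v)\to\mathrm{star}(\alpha(v))$ are bijections for all $v\in V(G_1)$. Graphs of objects. Let $\mathcal{C}$ be a category and let $\mathcal{M}_1\subset\mathcal{M}_2\subset\mathrm{Hom}(\mathcal{C})$ be such that $(\mathrm{Ob}(\mathcal{C}),\mathcal{M}_1)$ and $(\mathrm{Ob}(\mathcal{C}),\mathcal{M}_2)$ are subcategories, with $(\mathrm{Ob}(\mathcal{C}),\mathcal{M}_1)$ a groupoid (all its morphisms are invertible within it). A graph of objects $X$ with respect to $(\mathcal{C},\mathcal{M}_1,\mathcal{M}_2)$ consists of: a graph $G_X$; objects $X_v\in\mathrm{Ob}(\mathcal{C})$ for $v\in V(G_X)$; objects $X_e\in\mathrm{Ob}(\mathcal{C})$ for $e\in E(G_X)$ with $X_e=X_{\overline{e}}$; and morphisms $\phi^e_0:X_e\to X_{\partial_0e}$ and $\phi^e_1:X_e\to X_{\partial_1e}$ in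 $\mathcal{M}_2$ for $e\in E(G_X)$, such that $\phi^e_0=\phi^{\overline{e}}_1$ and $\phi^e_1=\phi^{\overline{e}}_0$. $X$ is finite if $G_X$ is finite. A morphism $f:X\to Y$ of graphs of objects (with respect to the same triple) consists of a graph morphism $\hat f:G_X\to G_Y$, morphisms $f_v:X_v\to Y_{\hat f(v)}$ in $\mathcal{M}_1$ for $v\in V(G_X)$, and morphisms $f_e:X_e\to Y_{\hat f(e)}$ in $\mathcal{M}_1$ for $e\in E(G_X)$, such that $f_e=f_{\overline{e}}$ and, for every edge $e$ from $u$ to $v$, $f_u\phi^e_0=\phi^{\hat f(e)}_0f_e$ and $f_v\phi^e_1=\phi^{\hat f(e)}_1f_e$. Composition is componentwise. $f$ is a covering (and $X$ is a cover of $Y$) if $\hat f$ is a covering of graphs. A morphism $f:X\to X$ is an automorphism if $\hat f$ is a graph automorphism; $\operatorname{Aut}(X)$ is the group of automorphisms. Deck transformations. If $f:\tilde X\to X$ is a covering of graphs of objects with $G_{\tilde X}$ a tree, then for each deck transformation $\gamma$ of the graph covering $\hat f:G_{\tilde X}\to G_X$ there is a unique automorphism $\rho(\gamma)\in\operatorname{Aut}(\tilde X)$ with $\widehat{\rho(\gamma)}=\gamma$, $f_v=f_{\gamma(v)}\rho(\gamma)_v$ and $f_e=f_{\gamma(e)}\rho(\gamma)_e$ for all vertices $v$ and edges $e$; the group of all $\rho(\gamma)$ is the group of deck transformations of $f$. Isotropy groups. For $H\leqslant\operatorname{Aut}(X)$ and $e\in E(G_X)$, the isotropy group of $e$ in $H$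 is $H(e):=\{h_e\mid h\in H,\ \hat h(e)=e\}\leqslant\operatorname{Aut}_{\mathcal{M}_1}(X_e)$ (the group of morphisms $X_e\to X_e$ in $\mathcal{M}_1$). $H$ has finite edge isotropy groups if $H(e)$ is finite for every $e\in E(G_X)$. Symmetry-restricted closure. For $H\leqslant\operatorname{Aut}(X)$, $\mathscr{S}(H)\leqslant\operatorname{Aut}(X)$ is the subgroup of automorphisms $g$ such that: (1) for all $e\in E(G_X)$ there exists $h\in H$ with $\hat g(e)=\hat h(e)$ and $g_e=h_e$; (2) for all $v\in V(G_X)$ there exists $h\in H$ with $\hat g(v)=\hat h(v)$ and $g_v=h_v$. *)

theory Defs
  imports "Graph_Theory.Graph_Theory" "HOL-Algebra.Group"
begin

section \<open>Graphs\<close>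

text \<open>
  A graph with oriented edges is a \<^locale>\<open>bidirected_digraph\<close>: the maps
  \<open>\<partial>\<^sub>0\<close>, \<open>\<partial>\<^sub>1\<close> are \<open>tail\<close>, \<open>head\<close>, and \<open>bar\<close> is the edge inversion. That locale also fixes
  \<open>bar\<close> to be the identity outside the edge set, which carries no mathematical content.
  Everything below is stated for record schemes, so that a graph of objects \<open>X\<close> is used
  directly in place of its underlying graph \<open>G\<^sub>X\<close>, and a morphism \<open>f\<close> in place of the
  underlying graph morphism.
\<close>

record ('v, 'e) ograph = "('v, 'e) pre_digraph" +
  bar :: "'e \<Rightarrow> 'e"

abbreviation digraph_of :: "('v, 'e, 'z) ograph_scheme \<Rightarrow> ('v, 'e) pre_digraph" where
  "digraph_of G \<equiv> pre_digraph.truncate G"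

definition is_ograph :: "('v, 'e, 'z) ograph_scheme \<Rightarrow> bool" where
  "is_ograph G \<longleftrightarrow> bidirected_digraph (digraph_of G) (bar G)"

definition star :: "('v, 'e, 'z) ograph_scheme \<Rightarrow> 'v \<Rightarrow> 'e set" where
  "star G v = out_arcs (digraph_of G) v"

definition finite_ograph :: "('v, 'e, 'z) ograph_scheme \<Rightarrow> bool" where
  "finite_ograph G \<longleftrightarrow> finite (verts G) \<and> finite (arcs G)"

definition reduced_walk :: "('v, 'e, 'z) ograph_scheme \<Rightarrow> 'e list \<Rightarrow> bool" where
  "reduced_walk G p \<longleftrightarrow> successively (\<lambda>e e'. e' \<noteq> bar G e) p"

text \<open>
  The library notion \<^const>\<open>pre_digraph.cycle\<close> counts a walk \<open>[e, bar G e]\<close> between distinct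
  vertices as a cycle; requiring the cycle to be reduced excludes exactly these. Loops and pairs
  of parallel edges are still cycles. Connected graphs are nonempty. (The library notion of a tree
  is unsuitable for the same reason: no bidirected digraph with an edge satisfies it.)
\<close>

definition is_tree :: "('v, 'e, 'z) ograph_scheme \<Rightarrow> bool" where
  "is_tree G \<longleftrightarrow> is_ograph G \<and> connected (digraph_of G) \<and>
     \<not> (\<exists>p. pre_digraph.cycle (digraph_of G) p \<and> reduced_walk G p)"

record ('v, 'e, 'w, 'd) ograph_mor =
  vmap :: "'v \<Rightarrow> 'w"
  emap :: "'e \<Rightarrow> 'd"

text \<open>
  Maps are extensional (undefined outside their domain), so that equality of records is equality
  of morphisms.
\<close>

definition graph_morphism ::
    "('v, 'e, 'y) ograph_scheme \<Rightarrow> ('w, 'd, 'z) ograph_scheme \<Rightarrow>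
     ('v, 'e, 'w, 'd, 'x) ograph_mor_scheme \<Rightarrow> bool" where
  "graph_morphism G G' \<alpha> \<longleftrightarrow>
     vmap \<alpha> \<in> verts G \<rightarrow>\<^sub>E verts G' \<and>
     emap \<alpha> \<in> arcs G \<rightarrow>\<^sub>E arcs G' \<and>
     (\<forall>e\<in>arcs G. tail G' (emap \<alpha> e) = vmap \<alpha> (tail G e) \<and>
                 head G' (emap \<alpha> e) = vmap \<alpha> (head G e) \<and>
                 bar G' (emap \<alpha> e) = emap \<alpha> (bar G e))"

definition graph_automorphism ::
    "('v, 'e, 'z) ograph_scheme \<Rightarrow> ('v, 'e, 'v, 'e, 'x) ograph_mor_scheme \<Rightarrow> bool" where
  "graph_automorphism G \<alpha> \<longleftrightarrow> graph_morphism G G \<alpha> \<and>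
     bij_betw (vmap \<alpha>) (verts G) (verts G) \<and> bij_betw (emap \<alpha>) (arcs G) (arcs G)"

definition graph_covering ::
    "('v, 'e, 'y) ograph_scheme \<Rightarrow> ('w, 'd, 'z) ograph_scheme \<Rightarrow>
     ('v, 'e, 'w, 'd, 'x) ograph_mor_scheme \<Rightarrow> bool" where
  "graph_covering G G' \<alpha> \<longleftrightarrow> graph_morphism G G' \<alpha> \<and>
     vmap \<alpha> ` verts G = verts G' \<and> emap \<alpha> ` arcs G = arcs G' \<and>
     (\<forall>v\<in>verts G. bij_betw (emap \<alpha>) (star G v) (star G' (vmap \<alpha> v)))"

definition graph_deck_transformation ::
    "('v, 'e, 'z) ograph_scheme \<Rightarrow> ('v, 'e, 'w, 'd, 'x) ograph_mor_scheme \<Rightarrow>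
     ('v, 'e, 'v, 'e, 'y) ograph_mor_scheme \<Rightarrow> bool" where
  "graph_deck_transformation G \<alpha> \<gamma> \<longleftrightarrow> graph_automorphism G \<gamma> \<and>
     (\<forall>v\<in>verts G. vmap \<alpha> (vmap \<gamma> v) = vmap \<alpha> v) \<and>
     (\<forall>e\<in>arcs G. emap \<alpha> (emap \<gamma> e) = emap \<alpha> e)"

section \<open>Categories\<close>

record ('o, 'm) cat =
  Ob :: "'o set"
  Mor :: "'m set"
  Dom :: "'m \<Rightarrow> 'o"
  Cod :: "'m \<Rightarrow> 'o"
  Id :: "'o \<Rightarrow> 'm"
  Comp :: "'m \<Rightarrow> 'm \<Rightarrow> 'm"  \<comment> \<open>\<open>Comp C g f\<close> is \<open>g\<close> after \<open>f\<close>\<close>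

locale category =
  fixes C :: "('o, 'm) cat"
  assumes Dom_in_Ob: "f \<in> Mor C \<Longrightarrow> Dom C f \<in> Ob C"
    and Cod_in_Ob: "f \<in> Mor C \<Longrightarrow> Cod C f \<in> Ob C"
    and Id_in_Mor: "A \<in> Ob C \<Longrightarrow> Id C A \<in> Mor C"
    and Dom_Id: "A \<in> Ob C \<Longrightarrow> Dom C (Id C A) = A"
    and Cod_Id: "A \<in> Ob C \<Longrightarrow> Cod C (Id C A) = A"
    and Comp_in_Mor: "\<lbrakk>f \<in> Mor C; g \<in> Mor C; Dom C g = Cod C f\<rbrakk> \<Longrightarrow> Comp C g f \<in> Mor C"
    and Dom_Comp: "\<lbrakk>f \<in> Mor C; g \<in> Mor C; Dom C g = Cod C f\<rbrakk> \<Longrightarrow> Dom C (Comp C g f) = Dom C f"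
    and Cod_Comp: "\<lbrakk>f \<in> Mor C; g \<in> Mor C; Dom C g = Cod C f\<rbrakk> \<Longrightarrow> Cod C (Comp C g f) = Cod C g"
    and Comp_Id: "f \<in> Mor C \<Longrightarrow> Comp C f (Id C (Dom C f)) = f"
    and Id_Comp: "f \<in> Mor C \<Longrightarrow> Comp C (Id C (Cod C f)) f = f"
    and Comp_assoc: "\<lbrakk>f \<in> Mor C; g \<in> Mor C; h \<in> Mor C; Dom C g = Cod C f; Dom C h = Cod C g\<rbrakk> \<Longrightarrow>
      Comp C h (Comp C g f) = Comp C (Comp C h g) f"

definition wide_subcategory :: "('o, 'm) cat \<Rightarrow> 'm set \<Rightarrow> bool" where
  "wide_subcategory C M \<longleftrightarrow> M \<subseteq> Mor C \<and> (\<forall>A\<in>Ob C. Id C A \<in> M) \<and>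
     (\<forall>f\<in>M. \<forall>g\<in>M. Dom C g = Cod C f \<longrightarrow> Comp C g f \<in> M)"

definition wide_subgroupoid :: "('o, 'm) cat \<Rightarrow> 'm set \<Rightarrow> bool" where
  "wide_subgroupoid C M \<longleftrightarrow> wide_subcategory C M \<and>
     (\<forall>f\<in>M. \<exists>g\<in>M. Dom C g = Cod C f \<and> Cod C g = Dom C f \<and>
        Comp C g f = Id C (Dom C f) \<and> Comp C f g = Id C (Cod C f))"

definition hom_in :: "('o, 'm) cat \<Rightarrow> 'm set \<Rightarrow> 'o \<Rightarrow> 'o \<Rightarrow> 'm set" where
  "hom_in C M A B = {f \<in> M. Dom C f = A \<and> Cod C f = B}"

locale object_triple = category C for C :: "('o, 'm) cat" +
  fixes M1 M2 :: "'m set"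
  assumes M1_subset_M2: "M1 \<subseteq> M2"
    and groupoid_M1: "wide_subgroupoid C M1"
    and subcategory_M2: "wide_subcategory C M2"

section \<open>Graphs of objects\<close>

record ('v, 'e, 'o, 'm) gobj = "('v, 'e) ograph" +
  vobj :: "'v \<Rightarrow> 'o"
  eobj :: "'e \<Rightarrow> 'o"
  phi0 :: "'e \<Rightarrow> 'm"
  phi1 :: "'e \<Rightarrow> 'm"

definition is_gobj :: "('o, 'm) cat \<Rightarrow> 'm set \<Rightarrow> ('v, 'e, 'o, 'm) gobj \<Rightarrow> bool" where
  "is_gobj C M2 X \<longleftrightarrow> is_ograph X \<and>
     (\<forall>v\<in>verts X. vobj X v \<in> Ob C) \<and>
     (\<forall>e\<in>arcs X. eobj X e \<in> Ob C \<and> eobj X (bar X e) = eobj X e \<and>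
        phi0 X e \<in> hom_in C M2 (eobj X e) (vobj X (tail X e)) \<and>
        phi1 X e \<in> hom_in C M2 (eobj X e) (vobj X (head X e)) \<and>
        phi0 X e = phi1 X (bar X e) \<and> phi1 X e = phi0 X (bar X e))"

record ('v, 'e, 'w, 'd, 'm) gobj_mor = "('v, 'e, 'w, 'd) ograph_mor" +
  vmor :: "'v \<Rightarrow> 'm"
  emor :: "'e \<Rightarrow> 'm"

definition gobj_morphism ::
    "('o, 'm) cat \<Rightarrow> 'm set \<Rightarrow> ('v, 'e, 'o, 'm) gobj \<Rightarrow> ('w, 'd, 'o, 'm) gobj \<Rightarrow>
     ('v, 'e, 'w, 'd, 'm) gobj_mor \<Rightarrow> bool" where
  "gobj_morphism C M1 X Y f \<longleftrightarrow> graph_morphism X Y f \<and>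
     vmor f \<in> (\<Pi>\<^sub>E v\<in>verts X. hom_in C M1 (vobj X v) (vobj Y (vmap f v))) \<and>
     emor f \<in> (\<Pi>\<^sub>E e\<in>arcs X. hom_in C M1 (eobj X e) (eobj Y (emap f e))) \<and>
     (\<forall>e\<in>arcs X. emor f (bar X e) = emor f e \<and>
        Comp C (vmor f (tail X e)) (phi0 X e) = Comp C (phi0 Y (emap f e)) (emor f e) \<and>
        Comp C (vmor f (head X e)) (phi1 X e) = Comp C (phi1 Y (emap f e)) (emor f e))"

definition gobj_covering ::
    "('o, 'm) cat \<Rightarrow> 'm set \<Rightarrow> ('v, 'e, 'o, 'm) gobj \<Rightarrow> ('w, 'd, 'o, 'm) gobj \<Rightarrow>
     ('v, 'e, 'w, 'd, 'm) gobj_mor \<Rightarrow> bool" where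
  "gobj_covering C M1 X Y f \<longleftrightarrow> gobj_morphism C M1 X Y f \<and> graph_covering X Y f"

text \<open>The composite of \<open>f\<close> and then \<open>g\<close>, where \<open>X\<close> is the domain of \<open>f\<close>.\<close>

definition gobj_comp ::
    "('o, 'm) cat \<Rightarrow> ('v, 'e, 'o, 'm) gobj \<Rightarrow> ('w, 'd, 'u, 'c, 'm) gobj_mor \<Rightarrow>
     ('v, 'e, 'w, 'd, 'm) gobj_mor \<Rightarrow> ('v, 'e, 'u, 'c, 'm) gobj_mor" where
  "gobj_comp C X g f =
     \<lparr>vmap = (\<lambda>v\<in>verts X. vmap g (vmap f v)),
      emap = (\<lambda>e\<in>arcs X. emap g (emap f e)),
      vmor = (\<lambda>v\<in>verts X. Comp C (vmor g (vmap f v)) (vmor f v)),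
      emor = (\<lambda>e\<in>arcs X. Comp C (emor g (emap f e)) (emor f e))\<rparr>"

definition gobj_id :: "('o, 'm) cat \<Rightarrow> ('v, 'e, 'o, 'm) gobj \<Rightarrow> ('v, 'e, 'v, 'e, 'm) gobj_mor" where
  "gobj_id C X =
     \<lparr>vmap = (\<lambda>v\<in>verts X. v), emap = (\<lambda>e\<in>arcs X. e),
      vmor = (\<lambda>v\<in>verts X. Id C (vobj X v)), emor = (\<lambda>e\<in>arcs X. Id C (eobj X e))\<rparr>"

definition Aut ::
    "('o, 'm) cat \<Rightarrow> 'm set \<Rightarrow> ('v, 'e, 'o, 'm) gobj \<Rightarrow> ('v, 'e, 'v, 'e, 'm) gobj_mor monoid" where
  "Aut C M1 X =
     \<lparr>carrier = {f. gobj_morphism C M1 X X f \<and> graph_automorphism X f},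
      mult = gobj_comp C X,
      one = gobj_id C X\<rparr>"

text \<open>
  The automorphisms \<open>\<rho>(\<gamma>)\<close> of \<open>X\<close>, where \<open>\<gamma>\<close> ranges over the deck transformations of the
  underlying graph covering of \<open>f\<close>; \<open>\<gamma>\<close> is the underlying graph morphism of \<open>g\<close>.
\<close>

definition deck_group ::
    "('o, 'm) cat \<Rightarrow> 'm set \<Rightarrow> ('v, 'e, 'o, 'm) gobj \<Rightarrow> ('v, 'e, 'w, 'd, 'm) gobj_mor \<Rightarrow>
     ('v, 'e, 'v, 'e, 'm) gobj_mor set" where
  "deck_group C M1 X f =
     {g \<in> carrier (Aut C M1 X). graph_deck_transformation X f g \<and>
        (\<forall>v\<in>verts X. vmor f v = Comp C (vmor f (vmap g v)) (vmor g v)) \<and>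
        (\<forall>e\<in>arcs X. emor f e = Comp C (emor f (emap g e)) (emor g e))}"

definition isotropy_group :: "('v, 'e, 'v, 'e, 'm) gobj_mor set \<Rightarrow> 'e \<Rightarrow> 'm set" where
  "isotropy_group H e = {emor h e | h. h \<in> H \<and> emap h e = e}"

definition finite_edge_isotropy ::
    "('v, 'e, 'o, 'm) gobj \<Rightarrow> ('v, 'e, 'v, 'e, 'm) gobj_mor set \<Rightarrow> bool" where
  "finite_edge_isotropy X H \<longleftrightarrow> (\<forall>e\<in>arcs X. finite (isotropy_group H e))"

definition symmetry_closure ::
    "('o, 'm) cat \<Rightarrow> 'm set \<Rightarrow> ('v, 'e, 'o, 'm) gobj \<Rightarrow> ('v, 'e, 'v, 'e, 'm) gobj_mor set \<Rightarrow>
     ('v, 'e, 'v, 'e, 'm) gobj_mor set" where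
  "symmetry_closure C M1 X H =
     {g \<in> carrier (Aut C M1 X).
        (\<forall>e\<in>arcs X. \<exists>h\<in>H. emap g e = emap h e \<and> emor g e = emor h e) \<and>
        (\<forall>v\<in>verts X. \<exists>h\<in>H. vmap g v = vmap h v \<and> vmor g v = vmor h v)}"

end

theory Submission
  imports Defs
begin

text \<open>
  The coverings \<open>F = f2 h\<close> of \<open>X2\<close>, for \<open>h\<close> in
  \<open>H\<close>, form a set \<open>\<Phi>\<close>. Comparing \<open>F\<close> with
  \<open>f1\<close> at an edge \<open>e\<close> of the tree gives the arc state of \<open>F\<close>
  at \<open>e\<close>: the edge \<open>F e\<close> of \<open>X2\<close> and the isomorphism from the
  object at \<open>f1 e\<close> to the object at \<open>F e\<close> whose composite with the
  morphism of \<open>f1\<close> at \<open>e\<close> is that of \<open>F\<close>. The germ of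
  \<open>F\<close> at a vertex \<open>v\<close> collects the states of \<open>F\<close> at the edges
  that start at \<open>v\<close>. As \<open>H\<close> contains the deck transformations of
  \<open>f1\<close>, the possible arc states and germs depend only on the edge \<open>f1 e\<close>
  and the vertex \<open>f1 v\<close> of \<open>X1\<close>. They are finite in number, because the
  edge isotropy groups and the stars are finite. Vertex isotropy groups may be infinite; for this
  reason a germ does not record the isomorphism at \<open>v\<close>, and one such isomorphism is
  chosen afterwards for each germ.

  A finite graph over \<open>X1\<close> and \<open>X2\<close> is now glued from germs. Its vertices
  over \<open>v1\<close> are copies of the germs at \<open>v1\<close>, its edges over
  \<open>e1\<close> are copies of the states at \<open>e1\<close>; an edge starts at a copy of a
  germ that contains its state, and inverting an edge inverts its state. Every germ at
  \<open>v1\<close> gets \<open>N / |germs v1|\<close> copies and every state at \<open>e1\<close>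
  gets \<open>N / |arc_states e1|\<close> copies, with one \<open>N\<close> for the whole graph. For
  the projections to be locally bijective, the number of copies of a state \<open>d\<close> at
  \<open>e1\<close> must be the number of copies of germs that contain \<open>d\<close>. By lemma
  \<open>germ_fibre_card\<close> the number of germs containing \<open>d\<close> is the same for all
  states \<open>d\<close> at \<open>e1\<close>, hence it is \<open>|germs v1| / |arc_states
  e1|\<close>, where \<open>v1\<close> is the initial vertex of \<open>e1\<close>; so the two
  numbers of copies agree. The same count works at the other end of the edge, since
  \<open>e1\<close> and its inverse have equally many states.

  This graph may be disconnected. A lift \<open>\<nu>1\<close> of \<open>f1\<close> to it covers one
  component, which is the required \<open>X\<close>, and a lift \<open>\<nu>2\<close> of
  \<open>f2\<close> covers the same component. Both have the tree as their source, so \<open>\<nu>1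
  = \<nu>2 g\<close> for an automorphism \<open>g\<close> (lemma \<open>covering_transport\<close>).
  By construction \<open>f2 g\<close> agrees at each vertex and at each edge with some member of
  \<open>\<Phi>\<close>, and then \<open>g\<close> agrees there with some element of
  \<open>H\<close>, because \<open>H\<close> contains the deck transformations of \<open>f2\<close>.
\<close>

section \<open>Walks in trees\<close>

lemma digraph_of_simps [simp]:
  "verts (digraph_of G) = verts G" "arcs (digraph_of G) = arcs G"
  "tail (digraph_of G) = tail G" "head (digraph_of G) = head G"
  by (simp_all add: pre_digraph.defs)

lemma star_iff: "e \<in> star G v \<longleftrightarrow> e \<in> arcs G \<and> tail G e = v"
  by (simp add: star_def out_arcs_def)

lemma is_ographI:
  assumes "\<And>e. e \<in> arcs G \<Longrightarrow> tail G e \<in> verts G"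
    and "\<And>e. e \<in> arcs G \<Longrightarrow> head G e \<in> verts G"
    and "\<And>e. e \<in> arcs G \<Longrightarrow> bar G e \<noteq> e"
    and "\<And>e. e \<in> arcs G \<Longrightarrow> bar G (bar G e) = e"
    and "\<And>e. e \<in> arcs G \<Longrightarrow> tail G (bar G e) = head G e"
    and "\<And>e. e \<notin> arcs G \<Longrightarrow> bar G e = e"
  shows "is_ograph G"
  unfolding is_ograph_def bidirected_digraph_def bidirected_digraph_axioms_def wf_digraph_def
proof (intro conjI allI impI)
  show "(e \<in> arcs (digraph_of G)) = (bar G e \<noteq> e)" for e
    using assms(3,6)[of e] by auto
qed (use assms in simp_all)

locale ograph =
  fixes G :: "('v, 'e, 'z) ograph_scheme"
  assumes is_ograph: "is_ograph G"
begin

sublocale bidirected_digraph "digraph_of G" "bar G"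
  using is_ograph by (simp add: is_ograph_def)

lemma bar_arcs [simp]: "e \<in> arcs G \<Longrightarrow> bar G e \<in> arcs G"
  using arev_in_arcs by simp

lemma tail_bar [simp]: "e \<in> arcs G \<Longrightarrow> tail G (bar G e) = head G e"
  using tail_arev by simp

lemma head_bar [simp]: "e \<in> arcs G \<Longrightarrow> head G (bar G e) = tail G e"
  using head_arev by simp

lemma tail_verts [simp]: "e \<in> arcs G \<Longrightarrow> tail G e \<in> verts G"
  using wellformed by simp

lemma head_verts [simp]: "e \<in> arcs G \<Longrightarrow> head G e \<in> verts G"
  using wellformed by simp

end

lemma not_successively_split:
  "\<not> successively P p \<Longrightarrow> \<exists>q a b r. p = q @ [a, b] @ r \<and> \<not> P a b"
proof (induction p rule: induct_list012)
  case (3 x y zs)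
  show ?case
  proof (cases "P x y")
    case True
    with 3 obtain q a b r where "y # zs = q @ [a, b] @ r" "\<not> P a b" by auto
    then show ?thesis by (intro exI[of _ "x # q"]) auto
  next
    case False
    then show ?thesis by (intro exI[of _ "[]"]) auto
  qed
qed auto

text \<open>
  A closed walk without backtracking cannot be a cycle in a tree, so it visits some vertex twice;
  the part between the two visits is a shorter closed walk without backtracking.
\<close>

lemma (in ograph) tree_closed_walk_backtracks:
  assumes tree: "is_tree G"
  shows "awalk u p u \<Longrightarrow> p \<noteq> [] \<Longrightarrow> \<exists>q e r. p = q @ [e, bar G e] @ r"
proof (induction "length p" arbitrary: u p rule: less_induct)
  case less
  show ?case
  proof (cases "reduced_walk G p")
    case False
    then show ?thesis
      unfolding reduced_walk_def using not_successively_split by fastforce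
  next
    case True
    have cas: "cas u p u" using less.prems by (simp add: awalk_def)
    have "\<not> distinct (tl (awalk_verts u p))"
      using tree True less.prems unfolding is_tree_def cycle_def by blast
    then have "\<not> distinct (map (head G) p)"
      using awalk_verts_conv'[OF cas] less.prems by simp
    then obtain xs y ys zs where "map (head G) p = xs @ y # ys @ y # zs"
      using not_distinct_decomp[of "map (head G) p"] by auto
    then obtain a x b y' c where p: "p = a @ x # b @ y' # c" "head G x = y" "head G y' = y"
      by (auto simp: map_eq_append_conv append_eq_map_conv Cons_eq_map_conv)
    have "awalk y (b @ [y']) y"
    proof -
      have "awalk u ((a @ [x]) @ ((b @ [y']) @ c)) u" using less.prems p by simp
      then obtain w w' where "awalk u (a @ [x]) w" "awalk w (b @ [y']) w'"
        by (auto simp only: awalk_append_iff)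
      moreover from this have "w = y" "w' = y"
        using p by (auto simp: awalk_append_iff awalk_Cons_iff awalk_Nil_iff)
      ultimately show ?thesis by simp
    qed
    then obtain q e r where "b @ [y'] = q @ [e, bar G e] @ r"
      using less.hyps[of "b @ [y']" y] p(1) by auto
    moreover have "p = a @ [x] @ (b @ [y']) @ c" using p(1) by simp
    ultimately have "p = (a @ x # q) @ [e, bar G e] @ (r @ c)"
      by simp
    then show ?thesis by blast
  qed
qed

lemma tree_nonempty: "is_tree G \<Longrightarrow> verts G \<noteq> {}"
  unfolding is_tree_def connected_def strongly_connected_def by simp

lemma (in ograph) tree_reachable:
  assumes tree: "is_tree G" and "u \<in> verts G" "v \<in> verts G"
  shows "\<exists>p. awalk u p v"
proof -
  have "symmetric (digraph_of G)"
  proof (unfold symmetric_def arcs_ends_def, rule symI)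
    fix x y
    assume "(x, y) \<in> arc_to_ends (digraph_of G) ` arcs (digraph_of G)"
    then obtain e where "e \<in> arcs G" "x = tail G e" "y = head G e"
      by (auto simp: arc_to_ends_def)
    then show "(y, x) \<in> arc_to_ends (digraph_of G) ` arcs (digraph_of G)"
      by (intro image_eqI[of _ _ "bar G e"]) (simp_all add: arc_to_ends_def)
  qed
  moreover have "connected (digraph_of G)" using tree by (simp add: is_tree_def)
  ultimately have "strongly_connected (digraph_of G)"
    by (rule symmetric_connected_imp_strongly_connected)
  then show ?thesis
    using assms(2,3) unfolding strongly_connected_def reachable_awalk by simp
qed

lemma (in ograph) tree_induct [consumes 3, case_names base step]:
  assumes "is_tree G" "v0 \<in> verts G" "v \<in> verts G"
    and base: "P v0"
    and step: "\<And>e. e \<in> arcs G \<Longrightarrow> P (tail G e) \<Longrightarrow> P (head G e)"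
  shows "P v"
proof -
  obtain p where "awalk v0 p v" using tree_reachable[OF assms(1-3)] by blast
  from this base show ?thesis
  proof (induction p arbitrary: v0)
    case (Cons e p)
    then show ?case using step by (auto simp: awalk_Cons_iff)
  qed (simp add: awalk_Nil_iff)
qed

section \<open>Lifting maps of trees\<close>

text \<open>
  This is the local half of being a covering. The projections of the glued graph have this property
  before a component is chosen, and lifting needs no more.
\<close>

definition locally_bijective ::
    "('v, 'e, 'y) ograph_scheme \<Rightarrow> ('w, 'd, 'z) ograph_scheme \<Rightarrow>
     ('v, 'e, 'w, 'd, 'x) ograph_mor_scheme \<Rightarrow> bool" where
  "locally_bijective G G' \<alpha> \<longleftrightarrow>
     (\<forall>v\<in>verts G. bij_betw (emap \<alpha>) (star G v) (star G' (vmap \<alpha> v)))"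

lemma graph_covering_iff:
  "graph_covering G G' \<alpha> \<longleftrightarrow> graph_morphism G G' \<alpha> \<and> locally_bijective G G' \<alpha> \<and>
     vmap \<alpha> ` verts G = verts G' \<and> emap \<alpha> ` arcs G = arcs G'"
  by (auto simp: graph_covering_def locally_bijective_def)

lemma graph_morphismD:
  assumes "graph_morphism G G' \<alpha>"
  shows "v \<in> verts G \<Longrightarrow> vmap \<alpha> v \<in> verts G'"
    and "e \<in> arcs G \<Longrightarrow> emap \<alpha> e \<in> arcs G'"
    and "e \<in> arcs G \<Longrightarrow> tail G' (emap \<alpha> e) = vmap \<alpha> (tail G e)"
    and "e \<in> arcs G \<Longrightarrow> head G' (emap \<alpha> e) = vmap \<alpha> (head G e)"
    and "e \<in> arcs G \<Longrightarrow> bar G' (emap \<alpha> e) = emap \<alpha> (bar G e)"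
  using assms by (auto simp: graph_morphism_def)

lemma locally_bijective_inj:
  assumes "locally_bijective G G' \<alpha>" "is_ograph G"
    and "a \<in> arcs G" "b \<in> arcs G" "tail G a = tail G b" "emap \<alpha> a = emap \<alpha> b"
  shows "a = b"
proof -
  interpret ograph G by (rule ograph.intro) fact
  have "inj_on (emap \<alpha>) (star G (tail G a))"
    using assms(1,3) by (auto simp: locally_bijective_def bij_betw_def)
  then show ?thesis using assms by (auto simp: star_iff dest: inj_onD)
qed

lemma locally_bijective_surj:
  assumes "locally_bijective G G' \<alpha>" "v \<in> verts G"
    and "d \<in> arcs G'" "tail G' d = vmap \<alpha> v"
  obtains e where "e \<in> arcs G" "tail G e = v" "emap \<alpha> e = d"
proof -
  have "d \<in> emap \<alpha> ` star G v"
    using assms by (auto simp: locally_bijective_def bij_betw_def star_iff)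
  then show ?thesis using that by (auto simp: star_iff)
qed

text \<open>
  Walks lift uniquely through a locally bijective map. Closed walks of a tree lift to closed walks,
  because they can be shortened by removing backtracks; so the end of the lift of a walk that starts
  at \<open>v0\<close> depends only on the end of the walk, which defines the lift on vertices.
\<close>

lemma tree_lift:
  assumes tree: "is_tree T" and G: "is_ograph G"
    and p: "graph_morphism G G' p" "locally_bijective G G' p"
    and f: "graph_morphism T G' f"
    and v0: "v0 \<in> verts T" and x0: "x0 \<in> verts G" "vmap p x0 = vmap f v0"
  obtains qv qe where "qv v0 = x0"
    and "\<forall>v\<in>verts T. qv v \<in> verts G \<and> vmap p (qv v) = vmap f v"
    and "\<forall>e\<in>arcs T. qe e \<in> arcs G \<and> emap p (qe e) = emap f e \<and>
           tail G (qe e) = qv (tail T e) \<and> head G (qe e) = qv (head T e) \<and>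
           bar G (qe e) = qe (bar T e)"
proof -
  interpret T: ograph T using tree by (auto simp: is_tree_def intro: ograph.intro)
  interpret G: ograph G by (rule ograph.intro) fact
  note pD = graph_morphismD[OF p(1)] and fD = graph_morphismD[OF f]
  define L where "L x e = inv_into (star G x) (emap p) (emap f e)" for x e
  have L_eq: "L (tail G a) e = a" if "a \<in> arcs G" "emap p a = emap f e" for a e
    unfolding L_def that(2)[symmetric]
    by (rule inv_into_f_f)
      (use p(2) that(1) in \<open>auto simp: locally_bijective_def bij_betw_def star_iff\<close>)
  have L: "L x e \<in> arcs G \<and> tail G (L x e) = x \<and> emap p (L x e) = emap f e"
    if xe: "x \<in> verts G" "e \<in> arcs T" "vmap p x = vmap f (tail T e)" for x e
  proof -
    obtain a where "a \<in> arcs G" "tail G a = x" "emap p a = emap f e"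
      using locally_bijective_surj[OF p(2) xe(1) fD(2)[OF xe(2)]] fD(3)[OF xe(2)] xe(3)
      by metis
    then show ?thesis using L_eq[of a e] by simp
  qed
  \<comment> \<open>The end of the lift of a walk, when the lift starts at \<open>x\<close>.\<close>
  define lw where "lw = foldl (\<lambda>x e. head G (L x e))"
  have lw_append: "lw x (es @ es') = lw (lw x es) es'" for x es es'
    by (simp add: lw_def)
  have lw: "lw x es \<in> verts G \<and> vmap p (lw x es) = vmap f v"
    if "T.awalk u es v" "x \<in> verts G" "vmap p x = vmap f u" for u es v x
    using that
  proof (induction es arbitrary: u x)
    case Nil
    then show ?case by (simp add: lw_def T.awalk_Nil_iff)
  next
    case (Cons e es)
    then have e: "e \<in> arcs T" "tail T e = u" "T.awalk (head T e) es v"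
      by (auto simp: T.awalk_Cons_iff)
    with L[of x e] Cons.prems
    have "head G (L x e) \<in> verts G" "vmap p (head G (L x e)) = vmap f (head T e)"
      by (auto simp: pD(4)[symmetric] fD(4)[symmetric])
    with Cons.IH[OF e(3)] show ?case by (simp add: lw_def)
  qed
  have lw_backtrack: "lw x [e, bar T e] = x"
    if "x \<in> verts G" "e \<in> arcs T" "vmap p x = vmap f (tail T e)" for x e
  proof -
    let ?a = "L x e"
    have a: "?a \<in> arcs G" "tail G ?a = x" "emap p ?a = emap f e" using L[OF that] by auto
    then have "L (tail G (bar G ?a)) (bar T e) = bar G ?a"
      using that(2) by (intro L_eq) (simp_all add: pD(5)[symmetric] fD(5)[symmetric])
    then show ?thesis using a by (simp add: lw_def)
  qed
  have lw_closed: "lw x es = x"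
    if "T.awalk u es u" "x \<in> verts G" "vmap p x = vmap f u" for u es x
    using that
  proof (induction "length es" arbitrary: es rule: less_induct)
    case less
    show ?case
    proof (cases "es = []")
      case False
      then obtain q e r where es: "es = q @ [e, bar T e] @ r"
        using T.tree_closed_walk_backtracks[OF tree less.prems(1)] by blast
      have "T.awalk u q (tail T e)" "e \<in> arcs T" "T.awalk (tail T e) r u"
        using less.prems(1) unfolding es
        by (auto simp: T.awalk_append_iff T.awalk_Cons_iff)
      moreover from this have "T.awalk u (q @ r) u" by (auto simp: T.awalk_append_iff)
      then have "lw x (q @ r) = x" using less.prems by (intro less.hyps) (auto simp: es)
      moreover have "lw (lw x q) [e, bar T e] = lw x q"
        using lw[OF calculation(1) less.prems(2,3)] calculation(2) by (intro lw_backtrack) auto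
      ultimately show ?thesis unfolding es lw_append by simp
    qed (simp add: lw_def)
  qed
  \<comment> \<open>The end of the lift of a walk depends only on the end of the walk: two walks to the same
    vertex differ by closed walks, one at each of their ends.\<close>
  have lw_unique: "lw x0 es = lw x0 es'" if es: "T.awalk v0 es v" and es': "T.awalk v0 es' v"
    for v es es'
  proof -
    have "v \<in> verts T" using T.awalk_last_in_verts[OF es] by simp
    then obtain c where c: "T.awalk v c v0" using T.tree_reachable[OF tree] v0 by blast
    have "lw x0 (es @ c) = x0"
      using es c x0 by (intro lw_closed) (auto simp: T.awalk_append_iff)
    moreover have "lw (lw x0 es) (c @ es') = lw x0 es"
      using es' c lw[OF es x0] by (intro lw_closed) (auto simp: T.awalk_append_iff)
    ultimately show ?thesis by (simp add: lw_append)
  qed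
  define qv where "qv v = lw x0 (SOME es. T.awalk v0 es v)" for v
  define qe where "qe e = L (qv (tail T e)) e" for e
  have qv_eq: "qv v = lw x0 es" if "T.awalk v0 es v" for v es
    unfolding qv_def by (rule lw_unique[OF someI that]) (fact that)
  have qv: "qv v \<in> verts G \<and> vmap p (qv v) = vmap f v" if v: "v \<in> verts T" for v
  proof -
    obtain es where es: "T.awalk v0 es v" using T.tree_reachable[OF tree v0 v] by blast
    show ?thesis using lw[OF es x0] by (simp add: qv_eq[OF es])
  qed
  have qe: "qe e \<in> arcs G \<and> emap p (qe e) = emap f e \<and> tail G (qe e) = qv (tail T e) \<and>
      head G (qe e) = qv (head T e)" if e: "e \<in> arcs T" for e
  proof -
    obtain es where es: "T.awalk v0 es (tail T e)"
      using T.tree_reachable[OF tree v0, of "tail T e"] e by auto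
    then have "T.awalk v0 (es @ [e]) (head T e)"
      using e by (auto simp: T.awalk_append_iff T.awalk_Cons_iff T.awalk_Nil_iff)
    from qv_eq[OF this] have "qv (head T e) = head G (qe e)"
      using qv_eq[OF es] by (simp add: qe_def lw_def)
    then show ?thesis using L[of "qv (tail T e)" e] qv[of "tail T e"] e by (simp add: qe_def)
  qed
  have "bar G (qe e) = qe (bar T e)" if e: "e \<in> arcs T" for e
    using qe[OF e] e L_eq[of "bar G (qe e)" "bar T e"]
    by (simp add: qe_def[of "bar T e"] pD(5)[symmetric] fD(5)[symmetric])
  moreover have "qv v0 = x0"
    using qv_eq[of "[]" v0] v0 by (simp add: T.awalk_Nil_iff lw_def)
  ultimately show ?thesis using that qv qe by blast
qed

section \<open>The category of graphs of objects\<close>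

context object_triple
begin

lemma M1_Mor [simp]: "m \<in> M1 \<Longrightarrow> m \<in> Mor C"
  using groupoid_M1 by (auto simp: wide_subgroupoid_def wide_subcategory_def)

lemma M2_Mor [simp]: "m \<in> M2 \<Longrightarrow> m \<in> Mor C"
  using subcategory_M2 by (auto simp: wide_subcategory_def)

lemma Comp_M1 [simp]: "g \<in> M1 \<Longrightarrow> f \<in> M1 \<Longrightarrow> Dom C g = Cod C f \<Longrightarrow> Comp C g f \<in> M1"
  using groupoid_M1 by (auto simp: wide_subgroupoid_def wide_subcategory_def)

lemma Id_M1 [simp]: "A \<in> Ob C \<Longrightarrow> Id C A \<in> M1"
  using groupoid_M1 by (auto simp: wide_subgroupoid_def wide_subcategory_def)

declare Comp_in_Mor [simp] Dom_Comp [simp] Cod_Comp [simp] Dom_Id [simp] Cod_Id [simp]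

definition ginv :: "'m \<Rightarrow> 'm" where
  "ginv f = (SOME g. g \<in> M1 \<and> Dom C g = Cod C f \<and> Cod C g = Dom C f \<and>
     Comp C g f = Id C (Dom C f) \<and> Comp C f g = Id C (Cod C f))"

lemma ginv:
  assumes "f \<in> M1"
  shows "ginv f \<in> M1" "Dom C (ginv f) = Cod C f" "Cod C (ginv f) = Dom C f"
    "Comp C (ginv f) f = Id C (Dom C f)" "Comp C f (ginv f) = Id C (Cod C f)"
proof -
  have "\<exists>g. g \<in> M1 \<and> Dom C g = Cod C f \<and> Cod C g = Dom C f \<and>
     Comp C g f = Id C (Dom C f) \<and> Comp C f g = Id C (Cod C f)"
    using groupoid_M1 assms by (auto simp: wide_subgroupoid_def)
  from someI_ex[OF this]
  show "ginv f \<in> M1" "Dom C (ginv f) = Cod C f" "Cod C (ginv f) = Dom C f"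
    "Comp C (ginv f) f = Id C (Dom C f)" "Comp C f (ginv f) = Id C (Cod C f)"
    by (auto simp: ginv_def)
qed

declare ginv(1-3) [simp]

lemma ginv_cancel_left [simp]:
  assumes "m \<in> M1" "a \<in> Mor C" "Cod C a = Dom C m"
  shows "Comp C (ginv m) (Comp C m a) = a"
  using assms by (subst Comp_assoc) (simp_all add: ginv Id_Comp flip: assms(3))

lemma cancel_ginv_left [simp]:
  assumes "m \<in> M1" "a \<in> Mor C" "Cod C a = Cod C m"
  shows "Comp C m (Comp C (ginv m) a) = a"
  using assms by (subst Comp_assoc) (simp_all add: ginv Id_Comp flip: assms(3))

lemma ginv_cancel_right [simp]:
  assumes "m \<in> M1" "a \<in> Mor C" "Dom C a = Dom C m"
  shows "Comp C (Comp C a (ginv m)) m = a"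
  using assms by (subst Comp_assoc[symmetric]) (simp_all add: ginv Comp_Id flip: assms(3))

lemma cancel_ginv_right [simp]:
  assumes "m \<in> M1" "a \<in> Mor C" "Dom C a = Cod C m"
  shows "Comp C (Comp C a m) (ginv m) = a"
  using assms by (subst Comp_assoc[symmetric]) (simp_all add: ginv Comp_Id flip: assms(3))

lemma M1_left_cancel:
  assumes "Comp C m a = Comp C m b" "m \<in> M1" "a \<in> Mor C" "b \<in> Mor C"
    "Cod C a = Dom C m" "Cod C b = Dom C m"
  shows "a = b"
  by (metis assms ginv_cancel_left)

lemma M1_right_cancel:
  assumes "Comp C a m = Comp C b m" "m \<in> M1" "a \<in> Mor C" "b \<in> Mor C"
    "Dom C a = Cod C m" "Dom C b = Cod C m"
  shows "a = b"
  by (metis assms cancel_ginv_right)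

lemma is_gobjD:
  assumes "is_gobj C M2 X"
  shows "is_ograph X" and "ograph X"
    and "v \<in> verts X \<Longrightarrow> vobj X v \<in> Ob C"
    and "e \<in> arcs X \<Longrightarrow> eobj X e \<in> Ob C"
    and "e \<in> arcs X \<Longrightarrow> eobj X (bar X e) = eobj X e"
    and "e \<in> arcs X \<Longrightarrow> phi0 X e \<in> Mor C"
    and "e \<in> arcs X \<Longrightarrow> Dom C (phi0 X e) = eobj X e"
    and "e \<in> arcs X \<Longrightarrow> Cod C (phi0 X e) = vobj X (tail X e)"
    and "e \<in> arcs X \<Longrightarrow> phi1 X e = phi0 X (bar X e)"
  using assms by (auto simp: is_gobj_def hom_in_def ograph_def)

lemma gobj_morphismD:
  assumes "gobj_morphism C M1 X Y f"
  shows "graph_morphism X Y f"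
    and "v \<in> verts X \<Longrightarrow> vmor f v \<in> M1"
    and "v \<in> verts X \<Longrightarrow> Dom C (vmor f v) = vobj X v"
    and "v \<in> verts X \<Longrightarrow> Cod C (vmor f v) = vobj Y (vmap f v)"
    and "e \<in> arcs X \<Longrightarrow> emor f e \<in> M1"
    and "e \<in> arcs X \<Longrightarrow> Dom C (emor f e) = eobj X e"
    and "e \<in> arcs X \<Longrightarrow> Cod C (emor f e) = eobj Y (emap f e)"
    and "e \<in> arcs X \<Longrightarrow> emor f (bar X e) = emor f e"
    and "e \<in> arcs X \<Longrightarrow>
      Comp C (vmor f (tail X e)) (phi0 X e) = Comp C (phi0 Y (emap f e)) (emor f e)"
  using assms by (auto simp: gobj_morphism_def hom_in_def)

text \<open>
  The condition at the terminal vertex of an edge is the condition at the initial vertex of the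
  inverse edge.
\<close>

lemma gobj_morphismI:
  assumes X: "is_gobj C M2 X" and Y: "is_gobj C M2 Y"
    and f: "graph_morphism X Y f"
    and ext: "vmor f \<in> extensional (verts X)" "emor f \<in> extensional (arcs X)"
    and v: "\<And>v. v \<in> verts X \<Longrightarrow> vmor f v \<in> M1 \<and> Dom C (vmor f v) = vobj X v \<and>
              Cod C (vmor f v) = vobj Y (vmap f v)"
    and e: "\<And>e. e \<in> arcs X \<Longrightarrow> emor f e \<in> M1 \<and> Dom C (emor f e) = eobj X e \<and>
              Cod C (emor f e) = eobj Y (emap f e)"
    and bar: "\<And>e. e \<in> arcs X \<Longrightarrow> emor f (bar X e) = emor f e"
    and compat: "\<And>e. e \<in> arcs X \<Longrightarrow>
      Comp C (vmor f (tail X e)) (phi0 X e) = Comp C (phi0 Y (emap f e)) (emor f e)"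
  shows "gobj_morphism C M1 X Y f"
proof -
  interpret X: ograph X using X by (rule is_gobjD)
  have "Comp C (vmor f (head X e)) (phi1 X e) = Comp C (phi1 Y (emap f e)) (emor f e)"
    if "e \<in> arcs X" for e
    using compat[of "bar X e"] that
    by (simp add: bar is_gobjD(9)[OF X] is_gobjD(9)[OF Y] graph_morphismD[OF f])
  then show ?thesis
    using f ext v e bar compat
    by (auto simp: gobj_morphism_def hom_in_def PiE_def)
qed

lemma gobj_mor_eqI:
  fixes f g :: "('v, 'e, 'w, 'd, 'm) gobj_mor"
  assumes f: "gobj_morphism C M1 X Y f" and g: "gobj_morphism C M1 X Z g"
    and "\<And>v. v \<in> verts X \<Longrightarrow> vmap f v = vmap g v \<and> vmor f v = vmor g v"
    and "\<And>e. e \<in> arcs X \<Longrightarrow> emap f e = emap g e \<and> emor f e = emor g e"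
  shows "f = g"
proof -
  have "vmap f = vmap g" "emap f = emap g" "vmor f = vmor g" "emor f = emor g"
    using assms
    by (auto simp: gobj_morphism_def graph_morphism_def PiE_def
        intro!: extensionalityI[where A = "verts X"] extensionalityI[where A = "arcs X"])
  then show ?thesis by simp
qed

lemma gobj_comp_simps [simp]:
  "v \<in> verts X \<Longrightarrow> vmap (gobj_comp C X g f) v = vmap g (vmap f v)"
  "e \<in> arcs X \<Longrightarrow> emap (gobj_comp C X g f) e = emap g (emap f e)"
  "v \<in> verts X \<Longrightarrow> vmor (gobj_comp C X g f) v = Comp C (vmor g (vmap f v)) (vmor f v)"
  "e \<in> arcs X \<Longrightarrow> emor (gobj_comp C X g f) e = Comp C (emor g (emap f e)) (emor f e)"
  by (simp_all add: gobj_comp_def)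

lemma gobj_comp_morphism:
  assumes X: "is_gobj C M2 X" and Y: "is_gobj C M2 Y" and Z: "is_gobj C M2 Z"
    and f: "gobj_morphism C M1 X Y f" and g: "gobj_morphism C M1 Y Z g"
  shows "gobj_morphism C M1 X Z (gobj_comp C X g f)"
proof -
  interpret X: ograph X using X by (rule is_gobjD)
  note fD = gobj_morphismD[OF f] and gD = gobj_morphismD[OF g]
  note f' [simp] = graph_morphismD[OF fD(1)] and g' [simp] = graph_morphismD[OF gD(1)]
  show ?thesis
  proof (rule gobj_morphismI[OF X Z])
    show "graph_morphism X Z (gobj_comp C X g f)"
      by (auto simp: graph_morphism_def gobj_comp_def)
    fix e assume e: "e \<in> arcs X"
    note [simp] = is_gobjD(4-8)[OF X] is_gobjD(4-8)[OF Y] is_gobjD(4-8)[OF Z]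
    note [simp] = fD(2-8) gD(2-8)
    have "Comp C (vmor (gobj_comp C X g f) (tail X e)) (phi0 X e) =
        Comp C (vmor g (tail Y (emap f e))) (Comp C (vmor f (tail X e)) (phi0 X e))"
      using e by (simp add: Comp_assoc)
    also have "\<dots> = Comp C (Comp C (vmor g (tail Y (emap f e))) (phi0 Y (emap f e))) (emor f e)"
      using e by (subst fD(9), simp) (subst Comp_assoc; simp)
    also have "\<dots> = Comp C (phi0 Z (emap (gobj_comp C X g f) e)) (emor (gobj_comp C X g f) e)"
      using e by (subst gD(9), simp) (simp add: Comp_assoc)
    finally show "Comp C (vmor (gobj_comp C X g f) (tail X e)) (phi0 X e) =
      Comp C (phi0 Z (emap (gobj_comp C X g f) e)) (emor (gobj_comp C X g f) e)" .
  next
    fix e assume e: "e \<in> arcs X"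
    show "emor (gobj_comp C X g f) (bar X e) = emor (gobj_comp C X g f) e"
      using e gD(8)[of "emap f e"] fD(8)[of e] by simp
  qed (use fD(2-7) gD(2-7) in \<open>simp_all add: gobj_comp_def\<close>)
qed

lemma gobj_comp_assoc:
  assumes W: "is_gobj C M2 W" and X: "is_gobj C M2 X" and Y: "is_gobj C M2 Y" and Z: "is_gobj C M2 Z"
    and f: "gobj_morphism C M1 W X f" and g: "gobj_morphism C M1 X Y g"
    and h: "gobj_morphism C M1 Y Z h"
  shows "gobj_comp C W h (gobj_comp C W g f) = gobj_comp C W (gobj_comp C X h g) f"
proof -
  note fD = gobj_morphismD[OF f] and gD = gobj_morphismD[OF g] and hD = gobj_morphismD[OF h]
  note [simp] = graph_morphismD[OF fD(1)] graph_morphismD[OF gD(1)] graph_morphismD[OF hD(1)]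
    fD(2-8) gD(2-8) hD(2-8)
  show ?thesis
    by (rule gobj_mor_eqI[OF gobj_comp_morphism[OF W Y Z gobj_comp_morphism[OF W X Y f g] h]
          gobj_comp_morphism[OF W X Z f gobj_comp_morphism[OF X Y Z g h]]])
      (simp_all add: Comp_assoc)
qed

lemma gobj_id_morphism:
  assumes X: "is_gobj C M2 X"
  shows "gobj_morphism C M1 X X (gobj_id C X)"
proof -
  interpret X: ograph X using X by (rule is_gobjD)
  note [simp] = is_gobjD(3-8)[OF X]
  have "Comp C (Id C (vobj X (tail X e))) (phi0 X e) = phi0 X e"
    "Comp C (phi0 X e) (Id C (eobj X e)) = phi0 X e" if "e \<in> arcs X" for e
    using that Id_Comp[of "phi0 X e"] Comp_Id[of "phi0 X e"] by simp_all
  then show ?thesis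
    by (intro gobj_morphismI[OF X X]) (auto simp: gobj_id_def graph_morphism_def)
qed

lemma gobj_comp_id_right:
  assumes X: "is_gobj C M2 X" and f: "gobj_morphism C M1 X Y f" and Y: "is_gobj C M2 Y"
  shows "gobj_comp C X f (gobj_id C X) = f"
proof -
  note fD = gobj_morphismD[OF f]
  have "Comp C (vmor f v) (Id C (vobj X v)) = vmor f v" if "v \<in> verts X" for v
    using that Comp_Id[of "vmor f v"] fD by simp
  moreover have "Comp C (emor f e) (Id C (eobj X e)) = emor f e" if "e \<in> arcs X" for e
    using that Comp_Id[of "emor f e"] fD by simp
  ultimately show ?thesis
    by (intro gobj_mor_eqI[OF gobj_comp_morphism[OF X X Y gobj_id_morphism[OF X] f] f])
      (simp_all add: gobj_id_def)
qed

lemma gobj_comp_id_left: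
  assumes X: "is_gobj C M2 X" and f: "gobj_morphism C M1 X Y f" and Y: "is_gobj C M2 Y"
  shows "gobj_comp C X (gobj_id C Y) f = f"
proof -
  note fD = gobj_morphismD[OF f]
  have "Comp C (Id C (vobj Y (vmap f v))) (vmor f v) = vmor f v" if "v \<in> verts X" for v
    using that Id_Comp[of "vmor f v"] fD by simp
  moreover have "Comp C (Id C (eobj Y (emap f e))) (emor f e) = emor f e" if "e \<in> arcs X" for e
    using that Id_Comp[of "emor f e"] fD by simp
  ultimately show ?thesis
    by (intro gobj_mor_eqI[OF gobj_comp_morphism[OF X Y Y f gobj_id_morphism[OF Y]] f])
      (simp_all add: gobj_id_def graph_morphismD[OF fD(1)])
qed

end

section \<open>Coverings of graphs of objects\<close>

lemma locally_bijective_comp: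
  assumes f: "graph_morphism X Y f" "locally_bijective X Y f" and g: "locally_bijective Y Z g"
  shows "locally_bijective X Z (gobj_comp C X g f)"
  unfolding locally_bijective_def
proof
  fix v assume v: "v \<in> verts X"
  have "bij_betw (emap g \<circ> emap f) (star X v) (star Z (vmap g (vmap f v)))"
    using v f g graph_morphismD(1)[OF f(1) v]
    by (intro bij_betw_trans) (auto simp: locally_bijective_def)
  also have "?this \<longleftrightarrow> bij_betw (emap (gobj_comp C X g f)) (star X v) (star Z (vmap g (vmap f v)))"
    by (rule bij_betw_cong) (simp add: star_iff gobj_comp_def)
  finally show "bij_betw (emap (gobj_comp C X g f)) (star X v)
      (star Z (vmap (gobj_comp C X g f) v))"
    using v by (simp add: gobj_comp_def)
qed

lemma locally_bijective_comp_cancel: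
  assumes Y: "is_ograph Y" and f: "graph_morphism X Y f" and g: "graph_morphism Y Z g"
    and lg: "locally_bijective Y Z g"
    and lgf: "locally_bijective X Z (gobj_comp C X g f)"
  shows "locally_bijective X Y f"
  unfolding locally_bijective_def
proof
  fix v assume v: "v \<in> verts X"
  note fD = graph_morphismD[OF f] and gD = graph_morphismD[OF g]
  have *: "bij_betw (emap (gobj_comp C X g f)) (star X v) (star Z (vmap g (vmap f v)))"
    using lgf v by (auto simp: locally_bijective_def gobj_comp_def)
  show "bij_betw (emap f) (star X v) (star Y (vmap f v))"
  proof (rule bij_betw_imageI)
    show "inj_on (emap f) (star X v)"
      using * unfolding bij_betw_def inj_on_def by (auto simp: gobj_comp_def star_iff)
    show "emap f ` star X v = star Y (vmap f v)"
    proof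
      show "star Y (vmap f v) \<subseteq> emap f ` star X v"
      proof
        fix d assume d: "d \<in> star Y (vmap f v)"
        then have "emap g d \<in> star Z (vmap g (vmap f v))" by (auto simp: star_iff gD)
        then obtain e where e: "e \<in> star X v" "emap g (emap f e) = emap g d"
          using * by (force simp: bij_betw_def gobj_comp_def star_iff image_iff)
        then have "emap f e = d"
          using locally_bijective_inj[OF lg Y, of "emap f e" d] d by (auto simp: star_iff fD)
        then show "d \<in> emap f ` star X v" using e by blast
      qed
    qed (auto simp: star_iff fD)
  qed
qed

context object_triple
begin

lemma gobj_coveringI:
  assumes Y: "is_gobj C M2 Y" and f: "gobj_morphism C M1 X Y f" "locally_bijective X Y f"
    and surj: "verts Y \<subseteq> vmap f ` verts X"
  shows "gobj_covering C M1 X Y f"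
proof -
  interpret Y: ograph Y using Y by (rule is_gobjD)
  note fD = graph_morphismD[OF gobj_morphismD(1)[OF f(1)]]
  have "arcs Y \<subseteq> emap f ` arcs X"
  proof
    fix d assume d: "d \<in> arcs Y"
    then obtain v where "v \<in> verts X" "tail Y d = vmap f v" using surj Y.tail_verts by blast
    then obtain e where "e \<in> arcs X" "emap f e = d"
      using locally_bijective_surj[OF f(2) _ d] by metis
    then show "d \<in> emap f ` arcs X" by blast
  qed
  then show ?thesis
    using f surj fD(1,2) gobj_morphismD(1)[OF f(1)]
    by (auto simp: gobj_covering_def graph_covering_iff)
qed

lemma gobj_coveringD:
  assumes "gobj_covering C M1 X Y f"
  shows "gobj_morphism C M1 X Y f" "locally_bijective X Y f"
    "vmap f ` verts X = verts Y" "emap f ` arcs X = arcs Y" "graph_morphism X Y f"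
  using assms by (auto simp: gobj_covering_def graph_covering_iff)

lemma gobj_covering_comp:
  assumes X: "is_gobj C M2 X" and Y: "is_gobj C M2 Y" and Z: "is_gobj C M2 Z"
    and f: "gobj_covering C M1 X Y f" and g: "gobj_covering C M1 Y Z g"
  shows "gobj_covering C M1 X Z (gobj_comp C X g f)"
proof (rule gobj_coveringI[OF Z])
  note fD = gobj_coveringD[OF f] and gD = gobj_coveringD[OF g]
  show "gobj_morphism C M1 X Z (gobj_comp C X g f)"
    by (rule gobj_comp_morphism[OF X Y Z fD(1) gD(1)])
  show "locally_bijective X Z (gobj_comp C X g f)"
    by (rule locally_bijective_comp[OF fD(5,2) gD(2)])
  show "verts Z \<subseteq> vmap (gobj_comp C X g f) ` verts X"
    unfolding fD(3)[symmetric] gD(3)[symmetric] by (force simp: gobj_comp_def)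
qed

text \<open>
  Over the lifted graph map, the morphisms at vertices and edges are forced, since those of \<open>p\<close> are
  invertible.
\<close>

lemma gobj_lift:
  fixes X :: "('v, 'e, 'o, 'm) gobj" and Y :: "('w, 'd, 'o, 'm) gobj"
  assumes tree: "is_tree X"
    and X: "is_gobj C M2 X" and Y: "is_gobj C M2 Y" and Z: "is_gobj C M2 Z"
    and p: "gobj_morphism C M1 Y Z p" "locally_bijective Y Z p"
    and f: "gobj_morphism C M1 X Z f"
    and base: "v0 \<in> verts X" "x0 \<in> verts Y" "vmap p x0 = vmap f v0"
  obtains q where "gobj_morphism C M1 X Y q" "gobj_comp C X p q = f" "vmap q v0 = x0"
proof -
  interpret X: ograph X using X by (rule is_gobjD)
  interpret Y: ograph Y using Y by (rule is_gobjD)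
  note pD = gobj_morphismD[OF p(1)] and fD = gobj_morphismD[OF f]
  note pG = graph_morphismD[OF pD(1)] and fG = graph_morphismD[OF fD(1)]
  obtain qv qe where qv0: "qv v0 = x0"
    and qv': "\<forall>v\<in>verts X. qv v \<in> verts Y \<and> vmap p (qv v) = vmap f v"
    and qe': "\<forall>e\<in>arcs X. qe e \<in> arcs Y \<and> emap p (qe e) = emap f e \<and>
           tail Y (qe e) = qv (tail X e) \<and> head Y (qe e) = qv (head X e) \<and>
           bar Y (qe e) = qe (bar X e)"
    by (rule tree_lift[OF tree is_gobjD(1)[OF Y] pD(1) p(2) fD(1) base])
  note qv = qv'[rule_format] and qe = qe'[rule_format]
  define q :: "('v, 'e, 'w, 'd, 'm) gobj_mor" where
    "q = \<lparr>vmap = (\<lambda>v\<in>verts X. qv v), emap = (\<lambda>e\<in>arcs X. qe e),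
      vmor = (\<lambda>v\<in>verts X. Comp C (ginv (vmor p (qv v))) (vmor f v)),
      emor = (\<lambda>e\<in>arcs X. Comp C (ginv (emor p (qe e))) (emor f e))\<rparr>"
  have q_simps [simp]:
    "v \<in> verts X \<Longrightarrow> vmap q v = qv v" "e \<in> arcs X \<Longrightarrow> emap q e = qe e"
    "v \<in> verts X \<Longrightarrow> vmor q v = Comp C (ginv (vmor p (qv v))) (vmor f v)"
    "e \<in> arcs X \<Longrightarrow> emor q e = Comp C (ginv (emor p (qe e))) (emor f e)" for v e
    by (simp_all add: q_def)
  note [simp] = is_gobjD(4-8)[OF X] is_gobjD(4-8)[OF Y] is_gobjD(4-8)[OF Z] fD(2-8) pD(2-8)
    pG(1-4) fG(1-4) qv qe
  have q: "gobj_morphism C M1 X Y q"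
  proof (rule gobj_morphismI[OF X Y])
    fix e assume e: "e \<in> arcs X"
    have "emor p (qe (bar X e)) = emor p (qe e)"
      using pD(8)[of "qe e"] qe[OF e] by simp
    then show "emor q (bar X e) = emor q e" using e by simp
    show "Comp C (vmor q (tail X e)) (phi0 X e) = Comp C (phi0 Y (emap q e)) (emor q e)"
    proof (rule M1_left_cancel[of "vmor p (qv (tail X e))"])
      have "Comp C (vmor p (qv (tail X e))) (Comp C (phi0 Y (emap q e)) (emor q e)) =
          Comp C (Comp C (vmor p (tail Y (qe e))) (phi0 Y (qe e))) (emor q e)"
        using e by (simp add: Comp_assoc)
      also have "\<dots> = Comp C (phi0 Z (emap f e)) (Comp C (emor p (qe e)) (emor q e))"
        using e by (subst pD(9), simp) (subst Comp_assoc[symmetric]; simp)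
      also have "\<dots> = Comp C (vmor f (tail X e)) (phi0 X e)"
        using e by (simp add: fD(9))
      also have "\<dots> = Comp C (Comp C (vmor p (qv (tail X e))) (vmor q (tail X e))) (phi0 X e)"
        using e by simp
      also have "\<dots> = Comp C (vmor p (qv (tail X e))) (Comp C (vmor q (tail X e)) (phi0 X e))"
        using e by (subst Comp_assoc; simp)
      finally show "Comp C (vmor p (qv (tail X e))) (Comp C (vmor q (tail X e)) (phi0 X e)) =
          Comp C (vmor p (qv (tail X e))) (Comp C (phi0 Y (emap q e)) (emor q e))" ..
    qed (use e in simp_all)
  qed (auto simp: graph_morphism_def q_def)
  moreover have "gobj_comp C X p q = f"
    by (rule gobj_mor_eqI[OF gobj_comp_morphism[OF X Y Z q p(1)] f]) simp_all
  moreover have "vmap q v0 = x0" using qv0 base by simp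
  ultimately show ?thesis using that by blast
qed

text \<open>
  Local injectivity of \<open>p\<close> propagates agreement of two lifts along the edges of the connected graph.
\<close>

lemma gobj_lift_unique:
  assumes tree: "is_tree X" and X: "is_gobj C M2 X" and Y: "is_gobj C M2 Y"
    and p: "gobj_morphism C M1 Y Z p" "locally_bijective Y Z p"
    and q: "gobj_morphism C M1 X Y q" and q': "gobj_morphism C M1 X Y q'"
    and eq: "gobj_comp C X p q = gobj_comp C X p q'"
    and base: "v0 \<in> verts X" "vmap q v0 = vmap q' v0"
  shows "q = q'"
proof -
  interpret X: ograph X using X by (rule is_gobjD)
  note pD = gobj_morphismD[OF p(1)] and qD = gobj_morphismD[OF q] and qD' = gobj_morphismD[OF q']
  note qG = graph_morphismD[OF qD(1)] and qG' = graph_morphismD[OF qD'(1)]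
  have E: "emap q e = emap q' e"
    if "e \<in> arcs X" "vmap q (tail X e) = vmap q' (tail X e)" for e
  proof (rule locally_bijective_inj[OF p(2) is_gobjD(1)[OF Y]])
    show "emap p (emap q e) = emap p (emap q' e)"
      using arg_cong[OF eq, of "\<lambda>f. emap f e"] that by simp
  qed (use that in \<open>simp_all add: qG qG'\<close>)
  have V: "vmap q v = vmap q' v" if "v \<in> verts X" for v
    using tree base(1) that
  proof (induction rule: X.tree_induct)
    case (step e)
    then show ?case using E[of e] qG(4)[of e] qG'(4)[of e] by simp
  qed fact
  show ?thesis
  proof (rule gobj_mor_eqI[OF q q'])
    fix v assume v: "v \<in> verts X"
    have "vmor q v = vmor q' v"
      by (rule M1_left_cancel[of "vmor p (vmap q v)"])
        (use arg_cong[OF eq, of "\<lambda>f. vmor f v"] v V[OF v] in \<open>simp_all add: pD qD qG qD' qG'\<close>)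
    then show "vmap q v = vmap q' v \<and> vmor q v = vmor q' v" using V[OF v] by simp
  next
    fix e assume e: "e \<in> arcs X"
    have "emap q e = emap q' e" using E V e by simp
    moreover from this have "emor q e = emor q' e"
      by (intro M1_left_cancel[of "emor p (emap q e)" "emor q e" "emor q' e"])
        (use arg_cong[OF eq, of "\<lambda>f. emor f e"] e in \<open>simp_all add: pD qD qG qD' qG'\<close>)
    ultimately show "emap q e = emap q' e \<and> emor q e = emor q' e" by simp
  qed
qed

section \<open>Automorphisms and deck transformations\<close>

lemma Aut_simps [simp]:
  "mult (Aut C M1 X) = gobj_comp C X" "one (Aut C M1 X) = gobj_id C X"
  by (simp_all add: Aut_def)

lemma gobj_id_simps [simp]:
  "v \<in> verts X \<Longrightarrow> vmap (gobj_id C X) v = v" "e \<in> arcs X \<Longrightarrow> emap (gobj_id C X) e = e"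
  by (simp_all add: gobj_id_def)

lemma AutD:
  assumes "g \<in> carrier (Aut C M1 X)"
  shows "gobj_morphism C M1 X X g" "graph_automorphism X g"
  using assms by (auto simp: Aut_def)

lemma Aut_covering:
  assumes X: "is_gobj C M2 X" and g: "g \<in> carrier (Aut C M1 X)"
  shows "gobj_covering C M1 X X g"
proof (rule gobj_coveringI[OF X AutD(1)[OF g]])
  have g': "graph_morphism X X g" "bij_betw (vmap g) (verts X) (verts X)"
    "bij_betw (emap g) (arcs X) (arcs X)"
    using AutD(2)[OF g] by (auto simp: graph_automorphism_def)
  note gD = graph_morphismD[OF g'(1)]
  interpret X: ograph X using X by (rule is_gobjD)
  show "verts X \<subseteq> vmap g ` verts X" using g'(2) by (simp add: bij_betw_def)
  show "locally_bijective X X g"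
    unfolding locally_bijective_def
  proof
    fix v assume v: "v \<in> verts X"
    show "bij_betw (emap g) (star X v) (star X (vmap g v))"
    proof (rule bij_betw_imageI)
      show "inj_on (emap g) (star X v)"
        using g'(3) by (auto simp: bij_betw_def star_iff elim: inj_on_subset)
      show "emap g ` star X v = star X (vmap g v)"
      proof
        show "star X (vmap g v) \<subseteq> emap g ` star X v"
        proof
          fix d assume "d \<in> star X (vmap g v)"
          moreover from this have "d \<in> emap g ` arcs X"
            using g'(3) by (auto simp: bij_betw_def star_iff)
          then obtain e where "e \<in> arcs X" "emap g e = d" by blast
          moreover have "tail X e = v"
            using calculation v g'(2) inj_onD[of "vmap g" "verts X" "tail X e" v]
            by (auto simp: star_iff gD bij_betw_def)
          ultimately show "d \<in> emap g ` star X v" by (auto simp: star_iff)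
        qed
      qed (auto simp: star_iff gD)
    qed
  qed
qed

text \<open>
  The lift of \<open>f\<close> through \<open>f'\<close> and the lift of \<open>f'\<close> through \<open>f\<close> are inverse to each other: both
  composites lift a covering through itself and fix a vertex. With \<open>f' = f\<close> this says that deck
  transformations act transitively on fibres, and with \<open>f\<close> the identity it inverts automorphisms.
\<close>

lemma covering_transport:
  assumes tree: "is_tree X" and X: "is_gobj C M2 X" and Z: "is_gobj C M2 Z"
    and f: "gobj_covering C M1 X Z f" and f': "gobj_covering C M1 X Z f'"
    and v: "v \<in> verts X" "v' \<in> verts X" "vmap f v = vmap f' v'"
  obtains g where "g \<in> carrier (Aut C M1 X)" "gobj_comp C X f' g = f" "vmap g v = v'"
proof -
  note fD = gobj_coveringD[OF f] and fD' = gobj_coveringD[OF f']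
  obtain g where g: "gobj_morphism C M1 X X g" "gobj_comp C X f' g = f" "vmap g v = v'"
    using gobj_lift[OF tree X X Z fD'(1,2) fD(1) v(1,2)] v(3) by metis
  obtain g' where g': "gobj_morphism C M1 X X g'" "gobj_comp C X f g' = f'" "vmap g' v' = v"
    using gobj_lift[OF tree X X Z fD(1,2) fD'(1) v(2,1)] v(3) by metis
  have id: "gobj_comp C X k h = gobj_id C X"
    if "gobj_morphism C M1 X X h" "gobj_comp C X a h = b" "gobj_morphism C M1 X X k"
      "gobj_comp C X b k = a" "gobj_morphism C M1 X Z a" "locally_bijective X Z a"
      "gobj_morphism C M1 X Z b" "locally_bijective X Z b"
      "w \<in> verts X" "vmap k (vmap h w) = w" for h k a b w
  proof (rule gobj_lift_unique[OF tree X X that(7,8) _ _ _ that(9)])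
    show "gobj_morphism C M1 X X (gobj_comp C X k h)"
      by (rule gobj_comp_morphism[OF X X X that(1,3)])
    show "gobj_comp C X b (gobj_comp C X k h) = gobj_comp C X b (gobj_id C X)"
      using gobj_comp_assoc[OF X X X Z that(1,3,7)] gobj_comp_id_right[OF X that(7) Z] that(2,4)
      by simp
  qed (use gobj_id_morphism[OF X] that(9,10) in simp_all)
  have "gobj_comp C X g' g = gobj_id C X"
    by (rule id[OF g(1,2) g'(1,2) fD'(1,2) fD(1,2) v(1)]) (simp add: g(3) g'(3))
  moreover have "gobj_comp C X g g' = gobj_id C X"
    by (rule id[OF g'(1,2) g(1,2) fD(1,2) fD'(1,2) v(2)]) (simp add: g(3) g'(3))
  moreover note gG = graph_morphismD[OF gobj_morphismD(1)[OF g(1)]]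
    and gG' = graph_morphismD[OF gobj_morphismD(1)[OF g'(1)]]
  ultimately have V: "\<forall>w\<in>verts X. vmap g' (vmap g w) = w \<and> vmap g (vmap g' w) = w"
    and E: "\<forall>e\<in>arcs X. emap g' (emap g e) = e \<and> emap g (emap g' e) = e"
    by (metis gobj_comp_simps(1) gobj_id_simps(1), metis gobj_comp_simps(2) gobj_id_simps(2))
  have "bij_betw (vmap g) (verts X) (verts X)"
    by (rule bij_betw_byWitness[where f' = "vmap g'"]) (use V gG gG' in auto)
  moreover have "bij_betw (emap g) (arcs X) (arcs X)"
    by (rule bij_betw_byWitness[where f' = "emap g'"]) (use E gG gG' in auto)
  ultimately have "g \<in> carrier (Aut C M1 X)"
    using g(1) gobj_morphismD(1)[OF g(1)] by (simp add: Aut_def graph_automorphism_def)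
  then show ?thesis using that g by blast
qed

lemma covering_transport_arc:
  assumes tree: "is_tree X" and X: "is_gobj C M2 X" and Z: "is_gobj C M2 Z"
    and f: "gobj_covering C M1 X Z f" and f': "gobj_covering C M1 X Z f'"
    and e: "e \<in> arcs X" "e' \<in> arcs X" "emap f e = emap f' e'"
  obtains g where "g \<in> carrier (Aut C M1 X)" "gobj_comp C X f' g = f" "emap g e = e'"
proof -
  interpret X: ograph X using X by (rule is_gobjD)
  note fD = gobj_coveringD[OF f] and fD' = gobj_coveringD[OF f']
  have "vmap f (tail X e) = vmap f' (tail X e')"
    using e graph_morphismD(3)[OF fD(5)] graph_morphismD(3)[OF fD'(5)] by metis
  then obtain g where g: "g \<in> carrier (Aut C M1 X)" "gobj_comp C X f' g = f"
      "vmap g (tail X e) = tail X e'"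
    using covering_transport[OF tree X Z f f' X.tail_verts[OF e(1)] X.tail_verts[OF e(2)]] by blast
  note gG = graph_morphismD[OF gobj_morphismD(1)[OF AutD(1)[OF g(1)]]]
  have "emap g e = e'"
  proof (rule locally_bijective_inj[OF fD'(2) is_gobjD(1)[OF X]])
    show "emap f' (emap g e) = emap f' e'"
      using arg_cong[OF g(2), of "\<lambda>f. emap f e"] e by simp
  qed (use e g gG in simp_all)
  then show ?thesis using that g by blast
qed

lemma gobj_id_Aut:
  assumes X: "is_gobj C M2 X"
  shows "gobj_id C X \<in> carrier (Aut C M1 X)"
proof -
  have "bij_betw (vmap (gobj_id C X)) (verts X) (verts X)"
    "bij_betw (emap (gobj_id C X)) (arcs X) (arcs X)"
    by (auto simp: gobj_id_def bij_betw_def inj_on_def)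
  then show ?thesis
    using gobj_id_morphism[OF X] gobj_morphismD(1)[OF gobj_id_morphism[OF X]]
    by (simp add: Aut_def graph_automorphism_def)
qed

text \<open>
  An automorphism is a covering of the tree by itself, so the lift of the identity through it is a
  right inverse; and a monoid in which all elements have right inverses is a group.
\<close>

lemma Aut_group:
  assumes tree: "is_tree X" and X: "is_gobj C M2 X"
  shows "group (Aut C M1 X)"
proof (rule groupI)
  let ?A = "Aut C M1 X"
  have mult: "gobj_comp C X f g \<in> carrier ?A" if "f \<in> carrier ?A" "g \<in> carrier ?A" for f g
  proof -
    note f = AutD[OF that(1), unfolded graph_automorphism_def]
      and g = AutD[OF that(2), unfolded graph_automorphism_def]
    have "bij_betw (vmap f \<circ> vmap g) (verts X) (verts X)"
      "bij_betw (emap f \<circ> emap g) (arcs X) (arcs X)"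
      using bij_betw_trans[of "vmap g" "verts X" "verts X" "vmap f" "verts X"]
        bij_betw_trans[of "emap g" "arcs X" "arcs X" "emap f" "arcs X"] f g by simp_all
    moreover have "bij_betw (vmap f \<circ> vmap g) (verts X) (verts X) \<longleftrightarrow>
      bij_betw (vmap (gobj_comp C X f g)) (verts X) (verts X)"
      "bij_betw (emap f \<circ> emap g) (arcs X) (arcs X) \<longleftrightarrow>
      bij_betw (emap (gobj_comp C X f g)) (arcs X) (arcs X)"
      by (rule bij_betw_cong, simp)+
    moreover note fg = gobj_comp_morphism[OF X X X g(1) f(1)]
    ultimately show ?thesis
      using fg gobj_morphismD(1)[OF fg] by (simp add: Aut_def graph_automorphism_def)
  qed
  have right_inv: "\<exists>g\<in>carrier ?A. gobj_comp C X f g = gobj_id C X" if f: "f \<in> carrier ?A" for f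
  proof -
    obtain v where v: "v \<in> verts X" using tree_nonempty[OF tree] by blast
    note cov = Aut_covering[OF X f] Aut_covering[OF X gobj_id_Aut[OF X]]
    have "v \<in> vmap f ` verts X" using v by (simp only: gobj_coveringD(3)[OF cov(1)])
    then obtain v' where v': "v' \<in> verts X" "vmap f v' = v" by blast
    have "vmap (gobj_id C X) v = vmap f v'" using v v' by simp
    then obtain g where "g \<in> carrier ?A" "gobj_comp C X f g = gobj_id C X"
      by (rule covering_transport[OF tree X X cov(2,1) v v'(1)])
    then show ?thesis by blast
  qed
  have assoc: "gobj_comp C X (gobj_comp C X f g) h = gobj_comp C X f (gobj_comp C X g h)"
    if "f \<in> carrier ?A" "g \<in> carrier ?A" "h \<in> carrier ?A" for f g h
    by (rule gobj_comp_assoc[OF X X X X AutD(1)[OF that(3)] AutD(1)[OF that(2)]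
          AutD(1)[OF that(1)], symmetric])
  have one: "gobj_comp C X f (gobj_id C X) = f" "gobj_comp C X (gobj_id C X) f = f"
    if "f \<in> carrier ?A" for f
    by (fact gobj_comp_id_right[OF X AutD(1)[OF that] X])
      (fact gobj_comp_id_left[OF X AutD(1)[OF that] X])
  show "x \<otimes>\<^bsub>?A\<^esub> y \<otimes>\<^bsub>?A\<^esub> z = x \<otimes>\<^bsub>?A\<^esub> (y \<otimes>\<^bsub>?A\<^esub> z)"
    if "x \<in> carrier ?A" "y \<in> carrier ?A" "z \<in> carrier ?A" for x y z
    by (simp only: Aut_simps assoc[OF that])
  show "\<exists>y\<in>carrier ?A. y \<otimes>\<^bsub>?A\<^esub> x = \<one>\<^bsub>?A\<^esub>" if x: "x \<in> carrier ?A" for x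
  proof -
    obtain y where y: "y \<in> carrier ?A" "gobj_comp C X x y = gobj_id C X"
      using right_inv[OF x] by blast
    obtain z where z: "z \<in> carrier ?A" "gobj_comp C X y z = gobj_id C X"
      using right_inv[OF y(1)] by blast
    have "gobj_comp C X x (gobj_comp C X y z) = x" by (simp only: z(2) one(1)[OF x])
    moreover have "gobj_comp C X (gobj_comp C X x y) z = z" by (simp only: y(2) one(2)[OF z(1)])
    ultimately have "x = z" by (simp only: assoc[OF x y(1) z(1)])
    then show ?thesis using y z by auto
  qed
  show "x \<otimes>\<^bsub>?A\<^esub> y \<in> carrier ?A" if "x \<in> carrier ?A" "y \<in> carrier ?A" for x y
    using mult[OF that] by simp
  show "\<one>\<^bsub>?A\<^esub> \<otimes>\<^bsub>?A\<^esub> x = x" if "x \<in> carrier ?A" for x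
    using one(2)[OF that] by simp
qed (simp add: gobj_id_Aut[OF X])

lemma deck_group_iff:
  assumes X: "is_gobj C M2 X" and Y: "is_gobj C M2 Y" and f: "gobj_morphism C M1 X Y f"
  shows "g \<in> deck_group C M1 X f \<longleftrightarrow> g \<in> carrier (Aut C M1 X) \<and> gobj_comp C X f g = f"
    (is "?L \<longleftrightarrow> ?R")
proof
  assume ?L
  then have g: "g \<in> carrier (Aut C M1 X)" by (simp add: deck_group_def)
  have D: "\<forall>v\<in>verts X. vmap f (vmap g v) = vmap f v"
    "\<forall>v\<in>verts X. vmor f v = Comp C (vmor f (vmap g v)) (vmor g v)"
    "\<forall>e\<in>arcs X. emap f (emap g e) = emap f e"
    "\<forall>e\<in>arcs X. emor f e = Comp C (emor f (emap g e)) (emor g e)"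
    using \<open>?L\<close> unfolding deck_group_def graph_deck_transformation_def by blast+
  have "gobj_comp C X f g = f"
    by (rule gobj_mor_eqI[OF gobj_comp_morphism[OF X X Y AutD(1)[OF g] f] f])
      (simp_all add: D(1,3) D(2,4)[rule_format, symmetric])
  with g show ?R by simp
next
  assume R: ?R
  have "vmap f (vmap g v) = vmap f v \<and> vmor f v = Comp C (vmor f (vmap g v)) (vmor g v)"
    if "v \<in> verts X" for v
    using arg_cong[OF conjunct2[OF R], of "\<lambda>f. vmap f v"]
      arg_cong[OF conjunct2[OF R], of "\<lambda>f. vmor f v"] that by simp
  moreover have "emap f (emap g e) = emap f e \<and> emor f e = Comp C (emor f (emap g e)) (emor g e)"
    if "e \<in> arcs X" for e
    using arg_cong[OF conjunct2[OF R], of "\<lambda>f. emap f e"]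
      arg_cong[OF conjunct2[OF R], of "\<lambda>f. emor f e"] that by simp
  ultimately show ?L
    unfolding deck_group_def graph_deck_transformation_def using R AutD(2) by blast
qed

section \<open>Pullbacks and finite copies\<close>

text \<open>
  Objects and structure morphisms can be pulled back along any graph morphism. Every graph of objects
  built below arises in this way.
\<close>

lemma pullback_gobj:
  assumes Y: "is_ograph Y" and X: "is_gobj C M2 X" and f: "graph_morphism Y X f"
    and vobj: "\<And>v. v \<in> verts Y \<Longrightarrow> vobj Y v = vobj X (vmap f v)"
    and eobj: "\<And>e. e \<in> arcs Y \<Longrightarrow> eobj Y e = eobj X (emap f e)"
    and phi0: "\<And>e. e \<in> arcs Y \<Longrightarrow> phi0 Y e = phi0 X (emap f e)"
    and phi1: "\<And>e. e \<in> arcs Y \<Longrightarrow> phi1 Y e = phi1 X (emap f e)"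
  shows "is_gobj C M2 Y"
proof -
  interpret Y: ograph Y using Y by (rule ograph.intro)
  note fD = graph_morphismD[OF f]
  have "eobj Y e \<in> Ob C \<and> eobj Y (bar Y e) = eobj Y e \<and>
      phi0 Y e \<in> hom_in C M2 (eobj Y e) (vobj Y (tail Y e)) \<and>
      phi1 Y e \<in> hom_in C M2 (eobj Y e) (vobj Y (head Y e)) \<and>
      phi0 Y e = phi1 Y (bar Y e) \<and> phi1 Y e = phi0 Y (bar Y e)" if e: "e \<in> arcs Y" for e
  proof -
    note simps = eobj[OF e] eobj[OF Y.bar_arcs[OF e]] phi0[OF e] phi0[OF Y.bar_arcs[OF e]]
      phi1[OF e] phi1[OF Y.bar_arcs[OF e]] vobj[OF Y.tail_verts[OF e]] vobj[OF Y.head_verts[OF e]]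
      fD(3-5)[OF e, symmetric]
    show ?thesis
      using X fD(2)[OF e] unfolding is_gobj_def simps by blast
  qed
  moreover have "vobj Y v \<in> Ob C" if "v \<in> verts Y" for v
    using vobj[OF that] is_gobjD(3)[OF X fD(1)[OF that]] by simp
  ultimately show ?thesis using Y unfolding is_gobj_def by blast
qed

lemma pullback_morphism:
  assumes Y: "is_gobj C M2 Y" and X: "is_gobj C M2 X" and f: "graph_morphism Y X f"
    and vobj: "\<And>v. v \<in> verts Y \<Longrightarrow> vobj Y v = vobj X (vmap f v)"
    and eobj: "\<And>e. e \<in> arcs Y \<Longrightarrow> eobj Y e = eobj X (emap f e)"
    and phi0: "\<And>e. e \<in> arcs Y \<Longrightarrow> phi0 Y e = phi0 X (emap f e)"
    and vmor: "vmor f = (\<lambda>v\<in>verts Y. Id C (vobj Y v))"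
    and emor: "emor f = (\<lambda>e\<in>arcs Y. Id C (eobj Y e))"
  shows "gobj_morphism C M1 Y X f"
proof (rule gobj_morphismI[OF Y X f])
  interpret Y: ograph Y by (rule is_gobjD[OF Y])
  fix e assume e: "e \<in> arcs Y"
  show "emor f (bar Y e) = emor f e"
    using e is_gobjD(5)[OF Y e] by (simp add: emor)
  show "Comp C (vmor f (tail Y e)) (phi0 Y e) = Comp C (phi0 X (emap f e)) (emor f e)"
    using Id_Comp[of "phi0 Y e"] Comp_Id[of "phi0 Y e"] is_gobjD(6-8)[OF Y e] e
    by (simp add: vmor emor flip: phi0[OF e])
qed (use is_gobjD(3,4)[OF Y] in \<open>simp_all add: vmor emor vobj[symmetric] eobj[symmetric]\<close>)

text \<open>
  The graph glued from germs below may be disconnected, and its vertices and edges are tuples. This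
  lemma extracts a union of components and renames it. The embedding is locally bijective, so maps
  from the tree into these components lift to the copy.
\<close>

lemma finite_subgraph_copy:
  fixes X :: "('v, 'e, 'o, 'm) gobj"
  assumes X: "is_gobj C M2 X" and fin: "finite_ograph X" and V: "V \<subseteq> verts X"
    and closed: "\<And>e. e \<in> arcs X \<Longrightarrow> tail X e \<in> V \<Longrightarrow> head X e \<in> V"
  obtains Y :: "(nat, nat, 'o, 'm) gobj" and \<iota>
  where "is_gobj C M2 Y" "finite_ograph Y" "gobj_morphism C M1 Y X \<iota>" "locally_bijective Y X \<iota>"
    "inj_on (vmap \<iota>) (verts Y)" "vmap \<iota> ` verts Y = V"
proof -
  interpret X: ograph X by (rule is_gobjD[OF X])
  define A where "A = {e \<in> arcs X. tail X e \<in> V}"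
  have fin': "finite V" "finite A"
    using fin V finite_subset by (auto simp: finite_ograph_def A_def)
  obtain a :: "'v \<Rightarrow> nat" where a: "inj_on a V"
    using finite_imp_inj_to_nat_seg[OF fin'(1)] by blast
  obtain b :: "'e \<Rightarrow> nat" where b: "inj_on b A"
    using finite_imp_inj_to_nat_seg[OF fin'(2)] by blast
  have A: "bar X e \<in> A" "e \<in> arcs X" "tail X e \<in> V" "head X e \<in> V" if "e \<in> A" for e
    using that closed by (auto simp: A_def)
  define a' where "a' = inv_into V a"
  define b' where "b' = inv_into A b"
  have a' [simp]: "a' (a v) = v" if "v \<in> V" for v using a that by (simp add: a'_def)
  have b' [simp]: "b' (b e) = e" if "e \<in> A" for e using b that by (simp add: b'_def)
  define Y :: "(nat, nat, 'o, 'm) gobj" where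
    "Y = \<lparr>verts = a ` V, arcs = b ` A, tail = (\<lambda>n. a (tail X (b' n))),
      head = (\<lambda>n. a (head X (b' n))), bar = (\<lambda>n. if n \<in> b ` A then b (bar X (b' n)) else n),
      vobj = vobj X \<circ> a', eobj = eobj X \<circ> b', phi0 = phi0 X \<circ> b', phi1 = phi1 X \<circ> b'\<rparr>"
  define \<iota> :: "(nat, nat, 'v, 'e, 'm) gobj_mor" where
    "\<iota> = \<lparr>vmap = restrict a' (a ` V), emap = restrict b' (b ` A),
      vmor = (\<lambda>n\<in>a ` V. Id C (vobj X (a' n))), emor = (\<lambda>n\<in>b ` A. Id C (eobj X (b' n)))\<rparr>"
  have Y_simps: "verts Y = a ` V" "arcs Y = b ` A" "tail Y n = a (tail X (b' n))"
    "head Y n = a (head X (b' n))" "bar Y n = (if n \<in> b ` A then b (bar X (b' n)) else n)"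
    "vobj Y n = vobj X (a' n)" "eobj Y n = eobj X (b' n)" "phi0 Y n = phi0 X (b' n)"
    "phi1 Y n = phi1 X (b' n)" for n
    by (simp_all add: Y_def)
  have \<iota>_simps: "n \<in> a ` V \<Longrightarrow> vmap \<iota> n = a' n" "n \<in> b ` A \<Longrightarrow> emap \<iota> n = b' n"
    "n \<in> a ` V \<Longrightarrow> vmor \<iota> n = Id C (vobj X (a' n))"
    "n \<in> b ` A \<Longrightarrow> emor \<iota> n = Id C (eobj X (b' n))" for n
    by (simp_all add: \<iota>_def)
  have Y_ograph: "is_ograph Y"
  proof (rule is_ographI)
    fix n assume "n \<in> arcs Y"
    then obtain e where e: "e \<in> A" "n = b e" by (auto simp: Y_simps)
    note Ae = A[OF e(1)]
    show "bar Y n \<noteq> n"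
    proof
      assume "bar Y n = n"
      then have "bar X e = e" using inj_onD[OF b _ Ae(1) e(1)] e by (simp add: Y_simps)
      then show False using X.arev_neq[of e] Ae(2) by simp
    qed
    show "tail Y n \<in> verts Y" "head Y n \<in> verts Y" "bar Y (bar Y n) = n"
      "tail Y (bar Y n) = head Y n"
      using e(1) Ae by (simp_all add: Y_simps e(2))
  qed (simp add: Y_simps)
  have \<iota>_graph: "graph_morphism Y X \<iota>"
    using V A unfolding graph_morphism_def by (auto simp: Y_simps \<iota>_def)
  have Y: "is_gobj C M2 Y"
    by (rule pullback_gobj[OF Y_ograph X \<iota>_graph]) (auto simp: Y_simps \<iota>_simps)
  have \<iota>_mor: "gobj_morphism C M1 Y X \<iota>"
    by (rule pullback_morphism[OF Y X \<iota>_graph])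
      (auto simp: Y_simps \<iota>_simps, auto simp: \<iota>_def Y_simps fun_eq_iff)
  have "locally_bijective Y X \<iota>"
    unfolding locally_bijective_def
  proof
    fix n assume "n \<in> verts Y"
    then obtain v where v: "v \<in> V" "n = a v" by (auto simp: Y_simps)
    have star: "star Y n = b ` star X v"
    proof (intro equalityI subsetI)
      fix k assume "k \<in> star Y n"
      then obtain e where "e \<in> A" "k = b e" "a (tail X e) = a v"
        by (auto simp: star_iff Y_simps v)
      then show "k \<in> b ` star X v"
        using inj_onD[OF a, of "tail X e" v] A[of e] v by (auto simp: star_iff)
    qed (use v in \<open>auto simp: star_iff Y_simps A_def\<close>)
    have "star X v \<subseteq> A" using v by (auto simp: star_iff A_def)
    then have "bij_betw b' (star Y n) (star X v)"
      unfolding star by (intro bij_betw_byWitness[where f' = b]) auto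
    then have "bij_betw (emap \<iota>) (star Y n) (star X v)"
      by (subst bij_betw_cong[where g = b']) (auto simp: star_iff Y_simps \<iota>_simps)
    then show "bij_betw (emap \<iota>) (star Y n) (star X (vmap \<iota> n))"
      using v by (simp add: \<iota>_simps)
  qed
  moreover have "inj_on (vmap \<iota>) (verts Y)"
    by (rule inj_onI) (auto simp: Y_simps \<iota>_simps)
  moreover have "vmap \<iota> ` verts Y = V"
    by (auto simp: Y_simps \<iota>_simps image_image)
  moreover have "finite_ograph Y" using fin' by (simp add: finite_ograph_def Y_simps)
  ultimately show ?thesis using that Y \<iota>_mor by blast
qed

end

section \<open>The coverings of the second graph given by the symmetries\<close>

locale leighton_setting = object_triple C M1 M2
  for C :: "('o, 'm) cat" and M1 M2 :: "'m set" +
  fixes Xt :: "('v, 'e, 'o, 'm) gobj"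
    and X1 :: "('v1, 'e1, 'o, 'm) gobj"
    and X2 :: "('v2, 'e2, 'o, 'm) gobj"
    and f1 :: "('v, 'e, 'v1, 'e1, 'm) gobj_mor"
    and f2 :: "('v, 'e, 'v2, 'e2, 'm) gobj_mor"
    and H :: "('v, 'e, 'v, 'e, 'm) gobj_mor set"
  assumes gobj_Xt: "is_gobj C M2 Xt"
    and gobj_X1: "is_gobj C M2 X1"
    and gobj_X2: "is_gobj C M2 X2"
    and cover_f1: "gobj_covering C M1 Xt X1 f1"
    and cover_f2: "gobj_covering C M1 Xt X2 f2"
    and finite_X1: "finite_ograph X1"
    and finite_X2: "finite_ograph X2"
    and tree_Xt: "is_tree Xt"
    and subgroup_H: "subgroup H (Aut C M1 Xt)"
    and deck_f1: "deck_group C M1 Xt f1 \<subseteq> H"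
    and deck_f2: "deck_group C M1 Xt f2 \<subseteq> H"
    and finite_isotropy: "finite_edge_isotropy Xt H"
begin

sublocale Xt: ograph Xt by (rule is_gobjD[OF gobj_Xt])
sublocale X1: ograph X1 by (rule is_gobjD[OF gobj_X1])
sublocale X2: ograph X2 by (rule is_gobjD[OF gobj_X2])

sublocale Aut_Xt: group "Aut C M1 Xt"
  by (rule Aut_group[OF tree_Xt gobj_Xt])

lemmas f1 = gobj_coveringD[OF cover_f1]
lemmas f2 = gobj_coveringD[OF cover_f2]
lemmas f1_graph = graph_morphismD[OF f1(5)]
lemmas f1_mor = gobj_morphismD(2-8)[OF f1(1)]

lemma H_Aut: "h \<in> H \<Longrightarrow> h \<in> carrier (Aut C M1 Xt)"
  using subgroup_H by (rule subgroup.mem_carrier)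

lemma H_comp: "h \<in> H \<Longrightarrow> k \<in> H \<Longrightarrow> gobj_comp C Xt h k \<in> H"
  using subgroup.m_closed[OF subgroup_H] by simp

lemma H_mor: "h \<in> H \<Longrightarrow> gobj_morphism C M1 Xt Xt h"
  by (rule AutD(1)[OF H_Aut])

lemmas comp_assoc_Xt = gobj_comp_assoc[OF gobj_Xt gobj_Xt gobj_Xt]

definition \<Phi> :: "('v, 'e, 'v2, 'e2, 'm) gobj_mor set" where
  "\<Phi> = gobj_comp C Xt f2 ` H"

lemma \<Phi>_covering: "F \<in> \<Phi> \<Longrightarrow> gobj_covering C M1 Xt X2 F"
  unfolding \<Phi>_def
  using gobj_covering_comp[OF gobj_Xt gobj_Xt gobj_X2 Aut_covering[OF gobj_Xt H_Aut] cover_f2]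
  by blast

lemma f2_in_\<Phi>: "f2 \<in> \<Phi>"
  unfolding \<Phi>_def
proof (rule image_eqI)
  show "gobj_id C Xt \<in> H" using subgroup.one_closed[OF subgroup_H] by simp
  show "f2 = gobj_comp C Xt f2 (gobj_id C Xt)"
    using gobj_comp_id_right[OF gobj_Xt f2(1) gobj_X2] by simp
qed

lemma \<Phi>_comp:
  assumes "F \<in> \<Phi>" "k \<in> H" shows "gobj_comp C Xt F k \<in> \<Phi>"
proof -
  obtain h where h: "h \<in> H" "F = gobj_comp C Xt f2 h" using assms(1) by (auto simp: \<Phi>_def)
  have "gobj_comp C Xt F k = gobj_comp C Xt f2 (gobj_comp C Xt h k)"
    unfolding h(2) by (rule comp_assoc_Xt[symmetric]) (use h assms(2) H_mor gobj_X2 f2 in auto)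
  then show ?thesis using H_comp[OF h(1) assms(2)] by (simp add: \<Phi>_def)
qed

text \<open>
  If \<open>F = f2 h\<close> and \<open>F g = f2 h'\<close>, then \<open>h g h'\<inverse>\<close> is a deck transformation of \<open>f2\<close>. This is where the
  hypothesis on the deck transformations of \<open>f2\<close> enters.
\<close>

lemma \<Phi>_quotient_in_H:
  assumes g: "g \<in> carrier (Aut C M1 Xt)" and F: "F \<in> \<Phi>" "gobj_comp C Xt F g \<in> \<Phi>"
  shows "g \<in> H"
proof -
  obtain h h' where h: "h \<in> H" "F = gobj_comp C Xt f2 h"
    and h': "h' \<in> H" "gobj_comp C Xt F g = gobj_comp C Xt f2 h'"
    using F by (auto simp: \<Phi>_def)
  let ?A = "Aut C M1 Xt"
  define d where "d = h \<otimes>\<^bsub>?A\<^esub> g \<otimes>\<^bsub>?A\<^esub> inv\<^bsub>?A\<^esub> h'"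
  note carr = H_Aut[OF h(1)] H_Aut[OF h'(1)] g
  have mor: "gobj_morphism C M1 Xt Xt k" if "k \<in> carrier ?A" for k using AutD(1)[OF that] .
  have comp: "gobj_comp C Xt f2 (a \<otimes>\<^bsub>?A\<^esub> b) = gobj_comp C Xt (gobj_comp C Xt f2 a) b"
    if "a \<in> carrier ?A" "b \<in> carrier ?A" for a b
    using comp_assoc_Xt[OF gobj_X2 mor[OF that(2)] mor[OF that(1)] f2(1)] by simp
  have "gobj_comp C Xt f2 d = gobj_comp C Xt (gobj_comp C Xt F g) (inv\<^bsub>?A\<^esub> h')"
    unfolding d_def h(2) using carr by (simp only: comp Aut_Xt.m_closed Aut_Xt.inv_closed)
  also have "\<dots> = gobj_comp C Xt f2 (h' \<otimes>\<^bsub>?A\<^esub> inv\<^bsub>?A\<^esub> h')"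
    unfolding h'(2) using carr by (simp only: comp Aut_Xt.inv_closed)
  also have "\<dots> = f2"
    using Aut_Xt.r_inv[OF carr(2)] gobj_comp_id_right[OF gobj_Xt f2(1) gobj_X2] by simp
  finally have "d \<in> deck_group C M1 Xt f2"
    using carr by (simp only: deck_group_iff[OF gobj_Xt gobj_X2 f2(1)] d_def
        Aut_Xt.m_closed Aut_Xt.inv_closed simp_thms)
  then have "d \<in> H" using deck_f2 by blast
  moreover have "g = inv\<^bsub>?A\<^esub> h \<otimes>\<^bsub>?A\<^esub> d \<otimes>\<^bsub>?A\<^esub> h'"
    unfolding d_def using carr
    by (simp only: Aut_Xt.m_assoc Aut_Xt.m_closed Aut_Xt.inv_closed Aut_Xt.l_inv
        Aut_Xt.r_one Aut_Xt.inv_solve_left)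
  ultimately show ?thesis
    using subgroup.m_closed[OF subgroup_H] subgroup.m_inv_closed[OF subgroup_H] h(1) h'(1) by metis
qed

lemma \<Phi>_agree_arc:
  assumes F: "F \<in> \<Phi>" "F' \<in> \<Phi>" and e: "e \<in> arcs Xt" "emap F' e = emap F e"
  obtains k where "k \<in> H" "F' = gobj_comp C Xt F k" "emap k e = e"
proof -
  obtain k where k: "k \<in> carrier (Aut C M1 Xt)" "gobj_comp C Xt F k = F'" "emap k e = e"
    by (rule covering_transport_arc[OF tree_Xt gobj_Xt gobj_X2 \<Phi>_covering[OF F(2)]
          \<Phi>_covering[OF F(1)] e(1) e(1) e(2)])
  moreover have "k \<in> H" by (rule \<Phi>_quotient_in_H[OF k(1) F(1)]) (simp add: k(2) F(2))
  ultimately show ?thesis using that by blast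
qed

lemma deck_vertex:
  assumes "v \<in> verts Xt" "v' \<in> verts Xt" "vmap f1 v = vmap f1 v'"
  obtains \<gamma> where "\<gamma> \<in> H" "gobj_comp C Xt f1 \<gamma> = f1" "vmap \<gamma> v = v'"
proof -
  obtain g where g: "g \<in> carrier (Aut C M1 Xt)" "gobj_comp C Xt f1 g = f1" "vmap g v = v'"
    by (rule covering_transport[OF tree_Xt gobj_Xt gobj_X1 cover_f1 cover_f1 assms])
  then have "g \<in> deck_group C M1 Xt f1"
    by (simp only: deck_group_iff[OF gobj_Xt gobj_X1 f1(1)] simp_thms)
  then show ?thesis using that g deck_f1 by blast
qed

lemma deck_arc:
  assumes "e \<in> arcs Xt" "e' \<in> arcs Xt" "emap f1 e = emap f1 e'"
  obtains \<gamma> where "\<gamma> \<in> H" "gobj_comp C Xt f1 \<gamma> = f1" "emap \<gamma> e = e'"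
proof -
  obtain g where g: "g \<in> carrier (Aut C M1 Xt)" "gobj_comp C Xt f1 g = f1" "emap g e = e'"
    by (rule covering_transport_arc[OF tree_Xt gobj_Xt gobj_X1 cover_f1 cover_f1 assms])
  then have "g \<in> deck_group C M1 Xt f1"
    by (simp only: deck_group_iff[OF gobj_Xt gobj_X1 f1(1)] simp_thms)
  then show ?thesis using that g deck_f1 by blast
qed

text \<open>
  To show that an automorphism \<open>g\<close> looks like an element of \<open>H\<close> at a vertex or at an edge, it is enough
  that \<open>f2 g\<close> looks like a member of \<open>\<Phi>\<close> there.
\<close>

lemma \<Phi>_local_vertex:
  assumes g: "g \<in> carrier (Aut C M1 Xt)" and F: "F \<in> \<Phi>" and v: "v \<in> verts Xt"
    and eq: "vmap F v = vmap f2 (vmap g v)" "vmor F v = Comp C (vmor f2 (vmap g v)) (vmor g v)"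
  shows "\<exists>h\<in>H. vmap g v = vmap h v \<and> vmor g v = vmor h v"
proof -
  note gD = gobj_morphismD[OF AutD(1)[OF g]] and f2D = gobj_morphismD[OF f2(1)]
  note gG = graph_morphismD[OF gD(1)]
  obtain k where k: "k \<in> carrier (Aut C M1 Xt)" "gobj_comp C Xt f2 k = F" "vmap k v = vmap g v"
    by (rule covering_transport[OF tree_Xt gobj_Xt gobj_X2 \<Phi>_covering[OF F] cover_f2 v gG(1)[OF v] eq(1)])
  note kD = gobj_morphismD[OF AutD(1)[OF k(1)]]
  have "vmor g v = vmor k v"
    by (rule M1_left_cancel[of "vmor f2 (vmap g v)"])
      (use arg_cong[OF k(2), of "\<lambda>f. vmor f v"] v k(3) eq(2) in
        \<open>simp_all add: gD(2-4) kD(2-4) f2D(2-4) gG(1)\<close>)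
  moreover have "k \<in> H" by (rule \<Phi>_quotient_in_H[OF k(1) f2_in_\<Phi>]) (simp add: k(2) F)
  ultimately show ?thesis using k(3) by metis
qed

lemma \<Phi>_local_arc:
  assumes g: "g \<in> carrier (Aut C M1 Xt)" and F: "F \<in> \<Phi>" and e: "e \<in> arcs Xt"
    and eq: "emap F e = emap f2 (emap g e)" "emor F e = Comp C (emor f2 (emap g e)) (emor g e)"
  shows "\<exists>h\<in>H. emap g e = emap h e \<and> emor g e = emor h e"
proof -
  note gD = gobj_morphismD[OF AutD(1)[OF g]] and f2D = gobj_morphismD[OF f2(1)]
  note gG = graph_morphismD[OF gD(1)]
  obtain k where k: "k \<in> carrier (Aut C M1 Xt)" "gobj_comp C Xt f2 k = F" "emap k e = emap g e"
    by (rule covering_transport_arc[OF tree_Xt gobj_Xt gobj_X2 \<Phi>_covering[OF F] cover_f2 e gG(2)[OF e] eq(1)])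
  note kD = gobj_morphismD[OF AutD(1)[OF k(1)]]
  have "emor g e = emor k e"
    by (rule M1_left_cancel[of "emor f2 (emap g e)"])
      (use arg_cong[OF k(2), of "\<lambda>f. emor f e"] e k(3) eq(2) in
        \<open>simp_all add: gD(5-7) kD(5-7) f2D(5-7) gG(2)\<close>)
  moreover have "k \<in> H" by (rule \<Phi>_quotient_in_H[OF k(1) f2_in_\<Phi>]) (simp add: k(2) F)
  ultimately show ?thesis using k(3) by metis
qed

end

section \<open>Arc states and germs\<close>

lemma card_image_cong_fibres:
  assumes "\<And>x y. x \<in> K \<Longrightarrow> y \<in> K \<Longrightarrow> f x = f y \<longleftrightarrow> g x = g y"
  shows "card (f ` K) = card (g ` K)"
proof (rule bij_betw_same_card)
  let ?h = "\<lambda>y. g (inv_into K f y)"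
  have h: "?h (f x) = g x" if "x \<in> K" for x
    using assms[of "inv_into K f (f x)" x] that f_inv_into_f[of "f x" f K]
    by (simp add: inv_into_into)
  show "bij_betw ?h (f ` K) (g ` K)"
  proof (rule bij_betw_imageI)
    show "inj_on ?h (f ` K)"
    proof (rule inj_onI)
      fix a b assume "a \<in> f ` K" "b \<in> f ` K" and eq: "?h a = ?h b"
      then obtain x y where "x \<in> K" "y \<in> K" "a = f x" "b = f y" by blast
      with eq show "a = b" using h assms by simp
    qed
    show "?h ` f ` K = g ` K"
      unfolding image_image by (rule image_cong) (simp_all add: h)
  qed
qed

context leighton_setting
begin

text \<open>
  The second component is an isomorphism from the object of \<open>X1\<close> at the image of \<open>e\<close> to an object of
  \<open>X2\<close>; unlike \<open>emor F e\<close>, it does not change when \<open>F\<close> and \<open>e\<close> are moved by a deck transformation of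
  \<open>f1\<close>.
\<close>

definition arc_state :: "('v, 'e, 'v2, 'e2, 'm) gobj_mor \<Rightarrow> 'e \<Rightarrow> 'e2 \<times> 'm" where
  "arc_state F e = (emap F e, Comp C (emor F e) (ginv (emor f1 e)))"

text \<open>
  Each state is tagged with the edge of \<open>X1\<close> below it, so that germs at different lifts of one vertex
  of \<open>X1\<close> can be compared.
\<close>

definition germ :: "('v, 'e, 'v2, 'e2, 'm) gobj_mor \<Rightarrow> 'v \<Rightarrow> ('e1 \<times> 'e2 \<times> 'm) set" where
  "germ F v = (\<lambda>e. (emap f1 e, arc_state F e)) ` star Xt v"

definition arc_states :: "'e1 \<Rightarrow> ('e2 \<times> 'm) set" where
  "arc_states e1 = {arc_state F e | F e. F \<in> \<Phi> \<and> e \<in> arcs Xt \<and> emap f1 e = e1}"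

definition germs :: "'v1 \<Rightarrow> ('e1 \<times> 'e2 \<times> 'm) set set" where
  "germs v1 = {germ F v | F v. F \<in> \<Phi> \<and> v \<in> verts Xt \<and> vmap f1 v = v1}"

lemmas \<Phi>_mor = gobj_coveringD(1)[OF \<Phi>_covering]

lemma \<Phi>_simps:
  assumes "F \<in> \<Phi>"
  shows "v \<in> verts Xt \<Longrightarrow> vmor F v \<in> M1"
    and "v \<in> verts Xt \<Longrightarrow> Dom C (vmor F v) = vobj Xt v"
    and "v \<in> verts Xt \<Longrightarrow> Cod C (vmor F v) = vobj X2 (vmap F v)"
    and "e \<in> arcs Xt \<Longrightarrow> emor F e \<in> M1"
    and "e \<in> arcs Xt \<Longrightarrow> Dom C (emor F e) = eobj Xt e"
    and "e \<in> arcs Xt \<Longrightarrow> Cod C (emor F e) = eobj X2 (emap F e)"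
    and "e \<in> arcs Xt \<Longrightarrow> emor F (bar Xt e) = emor F e"
  using gobj_morphismD(2-8)[OF \<Phi>_mor[OF assms]] by auto

lemma \<Phi>_graph:
  assumes "F \<in> \<Phi>"
  shows "v \<in> verts Xt \<Longrightarrow> vmap F v \<in> verts X2"
    and "e \<in> arcs Xt \<Longrightarrow> emap F e \<in> arcs X2"
    and "e \<in> arcs Xt \<Longrightarrow> tail X2 (emap F e) = vmap F (tail Xt e)"
    and "e \<in> arcs Xt \<Longrightarrow> head X2 (emap F e) = vmap F (head Xt e)"
    and "e \<in> arcs Xt \<Longrightarrow> bar X2 (emap F e) = emap F (bar Xt e)"
  using graph_morphismD[OF gobj_morphismD(1)[OF \<Phi>_mor[OF assms]]] by auto

lemma arc_state_bar:
  assumes "F \<in> \<Phi>" "e \<in> arcs Xt"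
  shows "arc_state F (bar Xt e) = (bar X2 (fst (arc_state F e)), snd (arc_state F e))"
  using assms by (simp add: arc_state_def \<Phi>_graph \<Phi>_simps f1_mor)

lemma arc_state_eq_iff:
  assumes "F \<in> \<Phi>" "F' \<in> \<Phi>" "e \<in> arcs Xt"
  shows "arc_state F e = arc_state F' e \<longleftrightarrow> emap F e = emap F' e \<and> emor F e = emor F' e"
proof -
  note m = \<Phi>_simps(4,5)[OF assms(1,3)] \<Phi>_simps(4,5)[OF assms(2,3)]
  have "emor F e = emor F' e"
    if "Comp C (emor F e) (ginv (emor f1 e)) = Comp C (emor F' e) (ginv (emor f1 e))"
    by (rule M1_right_cancel[OF that]) (simp_all add: m f1_mor assms)
  then show ?thesis by (auto simp: arc_state_def)
qed

lemma arc_state_deck: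
  assumes F: "F \<in> \<Phi>" and \<gamma>: "\<gamma> \<in> H" "gobj_comp C Xt f1 \<gamma> = f1" and e: "e \<in> arcs Xt"
  shows "arc_state F (emap \<gamma> e) = arc_state (gobj_comp C Xt F \<gamma>) e"
proof -
  note \<gamma>D = gobj_morphismD[OF H_mor[OF \<gamma>(1)]]
  note \<gamma>G = graph_morphismD[OF \<gamma>D(1)]
  let ?e = "emap \<gamma> e"
  have \<gamma>e: "?e \<in> arcs Xt" using \<gamma>G e by simp
  have f1e: "emor f1 e = Comp C (emor f1 ?e) (emor \<gamma> e)" "emap f1 ?e = emap f1 e"
    using arg_cong[OF \<gamma>(2), of "\<lambda>f. emor f e"] arg_cong[OF \<gamma>(2), of "\<lambda>f. emap f e"] e by simp_all
  have "Comp C (emor F ?e) (ginv (emor f1 ?e)) =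
      Comp C (Comp C (emor F ?e) (emor \<gamma> e)) (ginv (emor f1 e))"
  proof (rule M1_right_cancel[where m = "emor f1 e"])
    have "Comp C (Comp C (emor F ?e) (ginv (emor f1 ?e))) (emor f1 e) =
        Comp C (Comp C (Comp C (emor F ?e) (ginv (emor f1 ?e))) (emor f1 ?e)) (emor \<gamma> e)"
      unfolding f1e(1) by (rule Comp_assoc) (use \<gamma>e e \<gamma>D F \<Phi>_simps f1_mor in simp_all)
    also have "\<dots> = Comp C (emor F ?e) (emor \<gamma> e)"
      using \<gamma>e e F by (simp add: \<Phi>_simps f1_mor)
    also have "\<dots> = Comp C (Comp C (Comp C (emor F ?e) (emor \<gamma> e)) (ginv (emor f1 e))) (emor f1 e)"
      using \<gamma>e e F by (simp add: \<Phi>_simps f1_mor \<gamma>D(5-7))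
    finally show "Comp C (Comp C (emor F ?e) (ginv (emor f1 ?e))) (emor f1 e) = \<dots>" .
  qed (use \<gamma>e e F in \<open>simp_all add: \<Phi>_simps f1_mor \<gamma>D(5-7) f1e(2)\<close>)
  then show ?thesis using e by (simp add: arc_state_def)
qed

lemma germ_deck:
  assumes F: "F \<in> \<Phi>" and \<gamma>: "\<gamma> \<in> H" "gobj_comp C Xt f1 \<gamma> = f1" and v: "v \<in> verts Xt"
  shows "germ F (vmap \<gamma> v) = germ (gobj_comp C Xt F \<gamma>) v"
proof -
  have "star Xt (vmap \<gamma> v) = emap \<gamma> ` star Xt v"
    using gobj_coveringD(2)[OF Aut_covering[OF gobj_Xt H_Aut[OF \<gamma>(1)]]] v
    by (simp add: locally_bijective_def bij_betw_def)
  moreover have "emap f1 (emap \<gamma> e) = emap f1 e" if "e \<in> arcs Xt" for e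
    using arg_cong[OF \<gamma>(2), of "\<lambda>f. emap f e"] that by simp
  ultimately show ?thesis
    by (auto simp: germ_def image_image star_iff arc_state_deck[OF F \<gamma>] intro!: image_cong)
qed

lemma mem_germ_iff:
  assumes "e \<in> arcs Xt"
  shows "(emap f1 e, d) \<in> germ F (tail Xt e) \<longleftrightarrow> d = arc_state F e"
proof
  assume "(emap f1 e, d) \<in> germ F (tail Xt e)"
  then obtain a where a: "a \<in> arcs Xt" "tail Xt a = tail Xt e" "emap f1 a = emap f1 e"
    "d = arc_state F a"
    by (auto simp: germ_def star_iff)
  have "a = e"
    by (rule locally_bijective_inj[OF f1(2) is_gobjD(1)[OF gobj_Xt] a(1) assms a(2,3)])
  then show "d = arc_state F e" using a(4) by simp
qed (use assms in \<open>auto simp: germ_def star_iff\<close>)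

lemma germ_eq_iff:
  assumes "F \<in> \<Phi>" "F' \<in> \<Phi>"
  shows "germ F v = germ F' v \<longleftrightarrow>
    (\<forall>e\<in>star Xt v. emap F e = emap F' e \<and> emor F e = emor F' e)" (is "?L \<longleftrightarrow> ?R")
proof
  assume L: ?L
  show ?R
  proof
    fix e assume "e \<in> star Xt v"
    then have e: "e \<in> arcs Xt" "tail Xt e = v" by (simp_all add: star_iff)
    have "(emap f1 e, arc_state F e) \<in> germ F v" using mem_germ_iff[OF e(1)] e(2) by blast
    then have "(emap f1 e, arc_state F e) \<in> germ F' (tail Xt e)" by (simp only: L e(2))
    then have "arc_state F e = arc_state F' e" by (simp only: mem_germ_iff[OF e(1)])
    then show "emap F e = emap F' e \<and> emor F e = emor F' e"
      by (simp only: arc_state_eq_iff[OF assms e(1)])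
  qed
next
  assume R: ?R
  show ?L
    unfolding germ_def
  proof (rule image_cong[OF refl])
    fix e assume "e \<in> star Xt v"
    then show "(emap f1 e, arc_state F e) = (emap f1 e, arc_state F' e)"
      using arc_state_eq_iff[OF assms, of e] R by (simp add: star_iff)
  qed
qed

text \<open>
  Deck transformations of \<open>f1\<close> carry every lift of an edge to one fixed lift, and they can be absorbed
  into \<open>F\<close>.
\<close>

lemma arc_states_lift:
  assumes e: "e \<in> arcs Xt"
  shows "arc_states (emap f1 e) = (\<lambda>F. arc_state F e) ` \<Phi>"
proof
  show "arc_states (emap f1 e) \<subseteq> (\<lambda>F. arc_state F e) ` \<Phi>"
  proof
    fix d assume "d \<in> arc_states (emap f1 e)"
    then obtain F e' where F: "F \<in> \<Phi>" "e' \<in> arcs Xt" "emap f1 e' = emap f1 e" "d = arc_state F e'"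
      by (auto simp: arc_states_def)
    obtain \<gamma> where \<gamma>: "\<gamma> \<in> H" "gobj_comp C Xt f1 \<gamma> = f1" "emap \<gamma> e = e'"
      by (rule deck_arc[OF e F(2) F(3)[symmetric]])
    then show "d \<in> (\<lambda>F. arc_state F e) ` \<Phi>"
      using arc_state_deck[OF F(1) \<gamma>(1,2) e] \<Phi>_comp[OF F(1) \<gamma>(1)] F(4) by blast
  qed
qed (use e in \<open>auto simp: arc_states_def\<close>)

lemma germs_lift:
  assumes v: "v \<in> verts Xt"
  shows "germs (vmap f1 v) = (\<lambda>F. germ F v) ` \<Phi>"
proof
  show "germs (vmap f1 v) \<subseteq> (\<lambda>F. germ F v) ` \<Phi>"
  proof
    fix s assume "s \<in> germs (vmap f1 v)"
    then obtain F v' where F: "F \<in> \<Phi>" "v' \<in> verts Xt" "vmap f1 v' = vmap f1 v" "s = germ F v'"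
      by (auto simp: germs_def)
    obtain \<gamma> where \<gamma>: "\<gamma> \<in> H" "gobj_comp C Xt f1 \<gamma> = f1" "vmap \<gamma> v = v'"
      by (rule deck_vertex[OF v F(2) F(3)[symmetric]])
    then show "s \<in> (\<lambda>F. germ F v) ` \<Phi>"
      using germ_deck[OF F(1) \<gamma>(1,2) v] \<Phi>_comp[OF F(1) \<gamma>(1)] F(4) by blast
  qed
qed (use v in \<open>auto simp: germs_def\<close>)

lemma vert_lift:
  assumes "v1 \<in> verts X1" obtains v where "v \<in> verts Xt" "vmap f1 v = v1"
proof -
  have "v1 \<in> vmap f1 ` verts Xt" using assms by (simp only: f1(3))
  then show ?thesis using that by blast
qed

lemma arc_lift:
  assumes "e1 \<in> arcs X1" obtains e where "e \<in> arcs Xt" "emap f1 e = e1"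
proof -
  have "e1 \<in> emap f1 ` arcs Xt" using assms by (simp only: f1(4))
  then show ?thesis using that by blast
qed

lemma arc_states_nonempty:
  assumes "e1 \<in> arcs X1" shows "arc_states e1 \<noteq> {}"
proof -
  obtain e where e: "e \<in> arcs Xt" "emap f1 e = e1" using arc_lift[OF assms] .
  show ?thesis using arc_states_lift[OF e(1)] e(2) f2_in_\<Phi> by auto
qed

lemma germs_nonempty:
  assumes "v1 \<in> verts X1" shows "germs v1 \<noteq> {}"
proof -
  obtain v where v: "v \<in> verts Xt" "vmap f1 v = v1" using vert_lift[OF assms] .
  show ?thesis using germs_lift[OF v(1)] v(2) f2_in_\<Phi> by auto
qed

lemma arc_states_subset:
  assumes "(e2, m) \<in> arc_states e1" shows "e2 \<in> arcs X2"
  using assms \<Phi>_graph(2) by (auto simp: arc_states_def arc_state_def)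

lemma arc_states_bar:
  assumes "(e2, m) \<in> arc_states e1"
  shows "(bar X2 e2, m) \<in> arc_states (bar X1 e1)"
proof -
  obtain F e where F: "F \<in> \<Phi>" "e \<in> arcs Xt" "emap f1 e = e1" "(e2, m) = arc_state F e"
    using assms by (auto simp: arc_states_def)
  have "arc_state F (bar Xt e) = (bar X2 e2, m)"
    using arc_state_bar[OF F(1,2)] by (simp flip: F(4))
  moreover have "emap f1 (bar Xt e) = bar X1 e1" using F by (simp flip: f1_graph(5))
  ultimately show ?thesis using F(1) Xt.bar_arcs[OF F(2)] unfolding arc_states_def by force
qed

lemma card_arc_states_bar:
  assumes "e1 \<in> arcs X1"
  shows "card (arc_states (bar X1 e1)) = card (arc_states e1)"
proof (rule bij_betw_same_card)
  show "bij_betw (\<lambda>(e2, m). (bar X2 e2, m)) (arc_states (bar X1 e1)) (arc_states e1)"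
    by (rule bij_betw_byWitness[where f' = "\<lambda>(e2, m). (bar X2 e2, m)"])
      (use arc_states_bar[of _ _ e1] arc_states_bar[of _ _ "bar X1 e1"] in force)+
qed

text \<open>
  Two members of \<open>\<Phi>\<close> with the same value at \<open>e\<close> differ by an element of \<open>H\<close> that fixes \<open>e\<close>, so their
  states at \<open>e\<close> differ by an element of the isotropy group.
\<close>

lemma finite_arc_states:
  assumes "e1 \<in> arcs X1" shows "finite (arc_states e1)"
proof -
  obtain e where e: "e \<in> arcs Xt" "emap f1 e = e1" using arc_lift[OF assms] .
  have "finite ((\<lambda>F. arc_state F e) ` {F \<in> \<Phi>. emap F e = e2})" for e2
  proof (cases "{F \<in> \<Phi>. emap F e = e2} = {}")
    case False
    then obtain F0 where F0: "F0 \<in> \<Phi>" "emap F0 e = e2" by blast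
    have "(\<lambda>F. arc_state F e) ` {F \<in> \<Phi>. emap F e = e2} \<subseteq>
      (\<lambda>m. (e2, Comp C (Comp C (emor F0 e) m) (ginv (emor f1 e)))) ` isotropy_group H e"
    proof (rule image_subsetI)
      fix F assume "F \<in> {F \<in> \<Phi>. emap F e = e2}"
      then have F: "F \<in> \<Phi>" "emap F e = emap F0 e" using F0 by auto
      obtain k where k: "k \<in> H" "F = gobj_comp C Xt F0 k" "emap k e = e"
        using \<Phi>_agree_arc[OF F0(1) F(1) e(1) F(2)] .
      then have "emor k e \<in> isotropy_group H e" by (auto simp: isotropy_group_def)
      moreover have "arc_state F e = (e2, Comp C (Comp C (emor F0 e) (emor k e)) (ginv (emor f1 e)))"
        using k(3) F0(2) e(1) by (simp add: arc_state_def k(2))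
      ultimately show "arc_state F e \<in>
        (\<lambda>m. (e2, Comp C (Comp C (emor F0 e) m) (ginv (emor f1 e)))) ` isotropy_group H e"
        by blast
    qed
    moreover have "finite (isotropy_group H e)"
      using finite_isotropy e(1) by (simp add: finite_edge_isotropy_def)
    ultimately show ?thesis by (meson finite_imageI finite_subset)
  next
    case True
    then show ?thesis by (simp only: image_empty finite.emptyI)
  qed
  moreover have "(\<lambda>F. arc_state F e) ` \<Phi> =
      (\<Union>e2\<in>arcs X2. (\<lambda>F. arc_state F e) ` {F \<in> \<Phi>. emap F e = e2})"
    using \<Phi>_graph(2)[OF _ e(1)] by blast
  moreover have "finite (arcs X2)" using finite_X2 by (simp add: finite_ograph_def)
  ultimately show ?thesis using arc_states_lift[OF e(1)] e(2) by simp
qed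

lemma finite_germs: "finite (germs v1)"
proof (rule finite_subset)
  have "arc_state F e \<in> arc_states (emap f1 e)" if "F \<in> \<Phi>" "e \<in> arcs Xt" for F e
    using that unfolding arc_states_def by blast
  then show "germs v1 \<subseteq> Pow (Sigma (arcs X1) arc_states)"
    by (auto simp: germs_def germ_def star_iff f1_graph simp del: prod.collapse)
  show "finite (Pow (Sigma (arcs X1) arc_states))"
    using finite_X1 finite_arc_states by (simp add: finite_ograph_def)
qed

text \<open>
  Let \<open>K\<close> be the group of those elements of \<open>H\<close> that fix a lift \<open>e\<close> of \<open>e1\<close> and are trivial on its
  object. The members of \<open>\<Phi>\<close> with the same state as \<open>F0\<close> at \<open>e\<close> are the \<open>F0 k\<close> with \<open>k\<close> in \<open>K\<close>. Two of them
  have the same germ exactly if the two elements of \<open>K\<close> act in the same way on the star, and this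
  condition does not involve \<open>F0\<close>.
\<close>

lemma germ_fibre_card:
  assumes e1: "e1 \<in> arcs X1"
  obtains c where "\<And>d. d \<in> arc_states e1 \<Longrightarrow> card {s \<in> germs (tail X1 e1). (e1, d) \<in> s} = c"
proof -
  obtain e where e: "e \<in> arcs Xt" "emap f1 e = e1" using arc_lift[OF e1] .
  let ?v = "tail Xt e"
  define K where "K = {k \<in> H. emap k e = e \<and> emor k e = Id C (eobj Xt e)}"
  define restr where "restr k = (\<lambda>e\<in>star Xt ?v. (emap k e, emor k e))" for k :: "('v, 'e, 'v, 'e, 'm) gobj_mor"
  have tail: "tail X1 e1 = vmap f1 ?v" using f1_graph(3)[OF e(1)] e(2) by simp
  have "card {s \<in> germs (tail X1 e1). (e1, d) \<in> s} = card (restr ` K)" if d: "d \<in> arc_states e1" for d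
  proof -
    obtain F0 where F0: "F0 \<in> \<Phi>" "d = arc_state F0 e"
      using d arc_states_lift[OF e(1)] e(2) by auto
    note F0m = \<Phi>_simps(4-6)[OF F0(1) e(1)]
    have F0_Id: "Comp C (emor F0 e) (Id C (eobj Xt e)) = emor F0 e"
      using Comp_Id[of "emor F0 e"] F0m by simp
    have "{s \<in> germs (tail X1 e1). (e1, d) \<in> s} = (\<lambda>k. germ (gobj_comp C Xt F0 k) ?v) ` K"
    proof (intro equalityI subsetI)
      fix s assume "s \<in> {s \<in> germs (tail X1 e1). (e1, d) \<in> s}"
      then obtain F where F: "F \<in> \<Phi>" "s = germ F ?v" "(e1, d) \<in> germ F ?v"
        using germs_lift[of ?v] e tail by auto
      then have "arc_state F e = arc_state F0 e" using mem_germ_iff[OF e(1)] e(2) F0 by simp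
      then have Fe: "emap F e = emap F0 e" "emor F e = emor F0 e"
        using arc_state_eq_iff[OF F(1) F0(1) e(1)] by auto
      obtain k where k: "k \<in> H" "F = gobj_comp C Xt F0 k" "emap k e = e"
        using \<Phi>_agree_arc[OF F0(1) F(1) e(1) Fe(1)] .
      have "emor k e = Id C (eobj Xt e)"
      proof (rule M1_left_cancel[of "emor F0 e"])
        show "Comp C (emor F0 e) (emor k e) = Comp C (emor F0 e) (Id C (eobj Xt e))"
          using Fe(2) F0_Id e(1) k(3) unfolding k(2) by simp
      qed (use gobj_morphismD(5-7)[OF H_mor[OF k(1)] e(1)] k(3) F0m is_gobjD(4)[OF gobj_Xt e(1)]
          in simp_all)
      then show "s \<in> (\<lambda>k. germ (gobj_comp C Xt F0 k) ?v) ` K"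
        using k F(2) by (auto simp: K_def)
    next
      fix s assume "s \<in> (\<lambda>k. germ (gobj_comp C Xt F0 k) ?v) ` K"
      then obtain k where k: "k \<in> H" "emap k e = e" "emor k e = Id C (eobj Xt e)"
        "s = germ (gobj_comp C Xt F0 k) ?v" by (auto simp: K_def)
      note Fk = \<Phi>_comp[OF F0(1) k(1)]
      have "arc_state (gobj_comp C Xt F0 k) e = d"
        unfolding F0(2) using arc_state_eq_iff[OF Fk F0(1) e(1)] k(2,3) e(1) F0_Id by simp
      then have "(e1, d) \<in> s" using mem_germ_iff[OF e(1)] e(2) k(4) by auto
      moreover have "s \<in> germs (tail X1 e1)"
        unfolding tail using germs_lift[of ?v] e(1) Fk k(4) by simp
      ultimately show "s \<in> {s \<in> germs (tail X1 e1). (e1, d) \<in> s}" by simp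
    qed
    moreover have "card ((\<lambda>k. germ (gobj_comp C Xt F0 k) ?v) ` K) = card (restr ` K)"
    proof (rule card_image_cong_fibres)
      fix k k' assume "k \<in> K" "k' \<in> K"
      then have k: "k \<in> H" "emap k e = e" "k' \<in> H" "emap k' e = e" by (auto simp: K_def)
      note kD = gobj_morphismD[OF H_mor[OF k(1)]] and kD' = gobj_morphismD[OF H_mor[OF k(3)]]
      note kG = graph_morphismD[OF kD(1)] and kG' = graph_morphismD[OF kD'(1)]
      have v: "vmap k ?v = ?v" "vmap k' ?v = ?v"
        using kG(3)[OF e(1)] kG'(3)[OF e(1)] k by simp_all
      have *: "emap F0 (emap k a) = emap F0 (emap k' a) \<and>
          Comp C (emor F0 (emap k a)) (emor k a) = Comp C (emor F0 (emap k' a)) (emor k' a) \<longleftrightarrow>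
          emap k a = emap k' a \<and> emor k a = emor k' a" (is "?L \<longleftrightarrow> ?R") if "a \<in> star Xt ?v" for a
      proof
        assume L: ?L
        have a: "a \<in> arcs Xt" "tail Xt a = ?v" using that by (auto simp: star_iff)
        have "emap k a = emap k' a"
          by (rule locally_bijective_inj[OF gobj_coveringD(2)[OF \<Phi>_covering[OF F0(1)]]
                is_gobjD(1)[OF gobj_Xt]])
            (use L a v kG kG' in simp_all)
        moreover have "emor k a = emor k' a"
          by (rule M1_left_cancel[of "emor F0 (emap k a)"])
            (use L a calculation kG(2)[of a] in
              \<open>simp_all add: kD(5-7) kD'(5-7) \<Phi>_simps(4-6)[OF F0(1)]\<close>)
        ultimately show ?R ..
      qed simp
      show "germ (gobj_comp C Xt F0 k) ?v = germ (gobj_comp C Xt F0 k') ?v \<longleftrightarrow> restr k = restr k'"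
        unfolding germ_eq_iff[OF \<Phi>_comp[OF F0(1) k(1)] \<Phi>_comp[OF F0(1) k(3)]]
        using * by (auto simp: restr_def star_iff fun_eq_iff restrict_def)
    qed
    ultimately show ?thesis by simp
  qed
  then show ?thesis using that by blast
qed

section \<open>The finite graph of objects glued from germs\<close>

lemma germ_has_unique_arc_state:
  assumes e1: "e1 \<in> arcs X1" and s: "s \<in> germs (tail X1 e1)"
  shows "\<exists>!d. (e1, d) \<in> s" and "(e1, d) \<in> s \<Longrightarrow> d \<in> arc_states e1"
proof -
  obtain e where e: "e \<in> arcs Xt" "emap f1 e = e1" using arc_lift[OF e1] .
  have "tail X1 e1 = vmap f1 (tail Xt e)" using f1_graph(3)[OF e(1)] e(2) by simp
  then obtain F where F: "F \<in> \<Phi>" "s = germ F (tail Xt e)"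
    using s germs_lift[of "tail Xt e"] e(1) by auto
  have *: "(e1, d) \<in> s \<longleftrightarrow> d = arc_state F e" for d
    using mem_germ_iff[OF e(1)] by (simp only: F(2) e(2)[symmetric])
  show "\<exists>!d. (e1, d) \<in> s" unfolding * by blast
  show "(e1, d) \<in> s \<Longrightarrow> d \<in> arc_states e1"
    unfolding * using F(1) e unfolding arc_states_def by blast
qed

text \<open>
  Any positive common multiple of the numbers of germs would do. The glued graph has this many
  vertices over each vertex of \<open>X1\<close>.
\<close>

definition deg :: nat where
  "deg = (\<Prod>v\<in>verts X1. card (germs v))"

definition vert_mult :: "'v1 \<Rightarrow> nat" where
  "vert_mult v1 = deg div card (germs v1)"

definition arc_mult :: "'e1 \<Rightarrow> nat" where
  "arc_mult e1 = deg div card (arc_states e1)"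

lemma vert_mult:
  assumes "v1 \<in> verts X1"
  shows "vert_mult v1 * card (germs v1) = deg" "0 < vert_mult v1"
proof -
  have fin: "finite (verts X1)" using finite_X1 by (simp add: finite_ograph_def)
  have "card (germs v1) dvd deg"
    unfolding deg_def using fin assms by (rule dvd_prodI)
  then show *: "vert_mult v1 * card (germs v1) = deg" by (simp add: vert_mult_def)
  have "0 < deg"
    unfolding deg_def by (rule prod_pos) (use germs_nonempty finite_germs in \<open>simp add: card_gt_0_iff\<close>)
  with * show "0 < vert_mult v1" by (cases "vert_mult v1") auto
qed

text \<open>
  The copies of germs at which a copy of the state \<open>d\<close> over \<open>e1\<close> may start.
\<close>

definition slots :: "'e1 \<Rightarrow> 'e2 \<times> 'm \<Rightarrow> (('e1 \<times> 'e2 \<times> 'm) set \<times> nat) set" where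
  "slots e1 d = {s \<in> germs (tail X1 e1). (e1, d) \<in> s} \<times> {..<vert_mult (tail X1 e1)}"

lemma finite_slots: "finite (slots e1 d)"
  using finite_germs by (simp add: slots_def)

text \<open>
  The germs at the initial vertex of \<open>e1\<close> are partitioned by their state at \<open>e1\<close> into classes of equal
  size.
\<close>

lemma card_slots:
  assumes e1: "e1 \<in> arcs X1" and d: "d \<in> arc_states e1"
  shows "card (slots e1 d) = arc_mult e1"
proof -
  let ?fib = "\<lambda>d. {s \<in> germs (tail X1 e1). (e1, d) \<in> s}"
  obtain c where c: "\<And>d. d \<in> arc_states e1 \<Longrightarrow> card (?fib d) = c"
    using germ_fibre_card[OF e1] by blast
  note fin = finite_arc_states[OF e1]
  have "germs (tail X1 e1) = (\<Union>d\<in>arc_states e1. ?fib d)"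
  proof (intro equalityI subsetI)
    fix s assume s: "s \<in> germs (tail X1 e1)"
    obtain d where "(e1, d) \<in> s" using ex1_implies_ex[OF germ_has_unique_arc_state(1)[OF e1 s]] ..
    then show "s \<in> (\<Union>d\<in>arc_states e1. ?fib d)"
      using s germ_has_unique_arc_state(2)[OF e1 s] by blast
  qed blast
  also have "card \<dots> = (\<Sum>d\<in>arc_states e1. card (?fib d))"
  proof (rule card_UN_disjoint[OF fin])
    show "\<forall>d\<in>arc_states e1. finite (?fib d)" using finite_germs by simp
    have "?fib d \<inter> ?fib d' = {}" if "d \<noteq> d'" for d d'
    proof (rule equals0I)
      fix s assume "s \<in> ?fib d \<inter> ?fib d'"
      then have "s \<in> germs (tail X1 e1)" "(e1, d) \<in> s" "(e1, d') \<in> s" by auto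
      then show False using germ_has_unique_arc_state(1)[OF e1, of s] that by (metis (lifting))
    qed
    then show "\<forall>d\<in>arc_states e1. \<forall>d'\<in>arc_states e1. d \<noteq> d' \<longrightarrow> ?fib d \<inter> ?fib d' = {}" by blast
  qed
  finally have "card (germs (tail X1 e1)) = card (arc_states e1) * c" using c by simp
  then have "deg = card (arc_states e1) * (c * vert_mult (tail X1 e1))"
    using vert_mult(1)[of "tail X1 e1"] e1 by (simp add: mult.commute mult.left_commute)
  moreover have "card (arc_states e1) \<noteq> 0"
    using fin arc_states_nonempty[OF e1] by simp
  ultimately have "arc_mult e1 = c * vert_mult (tail X1 e1)" by (simp add: arc_mult_def)
  then show ?thesis using c[OF d] by (simp add: slots_def card_cartesian_product)
qed

definition slot :: "'e1 \<Rightarrow> 'e2 \<times> 'm \<Rightarrow> nat \<Rightarrow> ('e1 \<times> 'e2 \<times> 'm) set \<times> nat" where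
  "slot e1 d = (SOME t. bij_betw t {..<arc_mult e1} (slots e1 d))"

lemma slot_bij:
  assumes "e1 \<in> arcs X1" "d \<in> arc_states e1"
  shows "bij_betw (slot e1 d) {..<arc_mult e1} (slots e1 d)"
proof -
  have "\<exists>t. bij_betw t {..<arc_mult e1} (slots e1 d)"
    by (rule finite_same_card_bij) (simp_all add: finite_slots card_slots[OF assms])
  then show ?thesis unfolding slot_def by (rule someI_ex)
qed

fun flip :: "'e1 \<times> ('e2 \<times> 'm) \<times> nat \<Rightarrow> 'e1 \<times> ('e2 \<times> 'm) \<times> nat" where
  "flip (e1, (e2, m), j) = (bar X1 e1, (bar X2 e2, m), j)"

definition cover_arcs :: "('e1 \<times> ('e2 \<times> 'm) \<times> nat) set" where
  "cover_arcs = (SIGMA e1:arcs X1. arc_states e1 \<times> {..<arc_mult e1})"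

definition cover_tail :: "'e1 \<times> ('e2 \<times> 'm) \<times> nat \<Rightarrow> 'v1 \<times> ('e1 \<times> 'e2 \<times> 'm) set \<times> nat" where
  "cover_tail = (\<lambda>(e1, d, j). (tail X1 e1, slot e1 d j))"

text \<open>
  The arc \<open>(e1, d, j)\<close> is the \<open>j\<close>-th copy of the state \<open>d\<close> over \<open>e1\<close>, and the vertex \<open>(v1, s, i)\<close> is the
  \<open>i\<close>-th copy of the germ \<open>s\<close> at \<open>v1\<close>. The bijection \<open>slot e1 d\<close>
  places initial vertices only; the terminal vertex of an arc is the initial vertex of its inverse,
  for which \<open>slot\<close> makes an independent choice.
\<close>

definition cover ::
    "('v1 \<times> ('e1 \<times> 'e2 \<times> 'm) set \<times> nat, 'e1 \<times> ('e2 \<times> 'm) \<times> nat, 'o, 'm) gobj" where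
  "cover = \<lparr>verts = (SIGMA v1:verts X1. germs v1 \<times> {..<vert_mult v1}),
     arcs = cover_arcs, tail = cover_tail, head = cover_tail \<circ> flip,
     bar = (\<lambda>a. if a \<in> cover_arcs then flip a else a),
     vobj = vobj X1 \<circ> fst, eobj = eobj X1 \<circ> fst,
     phi0 = phi0 X1 \<circ> fst, phi1 = phi1 X1 \<circ> fst\<rparr>"

text \<open>
  A covering in \<open>\<Phi>\<close> that realises a given germ. It also supplies what the germ leaves out: the image of
  the vertex in \<open>X2\<close> and the isomorphism of vertex objects.
\<close>

definition rep :: "'v1 \<Rightarrow> ('e1 \<times> 'e2 \<times> 'm) set \<Rightarrow> ('v, 'e, 'v2, 'e2, 'm) gobj_mor \<times> 'v" where
  "rep v1 s = (SOME (F, v). F \<in> \<Phi> \<and> v \<in> verts Xt \<and> vmap f1 v = v1 \<and> germ F v = s)"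

definition proj1 ::
    "('v1 \<times> ('e1 \<times> 'e2 \<times> 'm) set \<times> nat, 'e1 \<times> ('e2 \<times> 'm) \<times> nat, 'v1, 'e1, 'm) gobj_mor" where
  "proj1 = \<lparr>vmap = restrict fst (verts cover), emap = restrict fst cover_arcs,
     vmor = (\<lambda>x\<in>verts cover. Id C (vobj X1 (fst x))),
     emor = (\<lambda>a\<in>cover_arcs. Id C (eobj X1 (fst a)))\<rparr>"

definition proj2 ::
    "('v1 \<times> ('e1 \<times> 'e2 \<times> 'm) set \<times> nat, 'e1 \<times> ('e2 \<times> 'm) \<times> nat, 'v2, 'e2, 'm) gobj_mor" where
  "proj2 = \<lparr>vmap = (\<lambda>(v1, s, i)\<in>verts cover. case rep v1 s of (F, v) \<Rightarrow> vmap F v),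
     emap = (\<lambda>(e1, (e2, m), j)\<in>cover_arcs. e2),
     vmor = (\<lambda>(v1, s, i)\<in>verts cover. case rep v1 s of (F, v) \<Rightarrow>
       Comp C (vmor F v) (ginv (vmor f1 v))),
     emor = (\<lambda>(e1, (e2, m), j)\<in>cover_arcs. m)\<rparr>"

lemma rep:
  assumes "s \<in> germs v1"
  obtains F v where "rep v1 s = (F, v)" "F \<in> \<Phi>" "v \<in> verts Xt" "vmap f1 v = v1" "germ F v = s"
proof -
  have "\<exists>p. (\<lambda>(F, v). F \<in> \<Phi> \<and> v \<in> verts Xt \<and> vmap f1 v = v1 \<and> germ F v = s) p"
    using assms unfolding germs_def by auto
  from someI_ex[OF this] show ?thesis
    using that unfolding rep_def by (auto split: prod.splits)
qed

lemma cover_simps [simp]: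
  "verts cover = (SIGMA v1:verts X1. germs v1 \<times> {..<vert_mult v1})" "arcs cover = cover_arcs"
  "tail cover a = cover_tail a" "head cover a = cover_tail (flip a)"
  "a \<in> cover_arcs \<Longrightarrow> bar cover a = flip a" "a \<notin> cover_arcs \<Longrightarrow> bar cover a = a"
  "vobj cover x = vobj X1 (fst x)" "eobj cover a = eobj X1 (fst a)"
  "phi0 cover a = phi0 X1 (fst a)" "phi1 cover a = phi1 X1 (fst a)"
  by (simp_all add: cover_def)

lemma flip_arcs [simp]: "a \<in> cover_arcs \<Longrightarrow> flip a \<in> cover_arcs"
  using arc_states_bar card_arc_states_bar by (auto simp: cover_arcs_def arc_mult_def)

lemma flip_flip [simp]: "flip (flip a) = a"
  by (cases a rule: flip.cases) simp

lemma fst_flip [simp]: "fst (flip a) = bar X1 (fst a)"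
  by (cases a rule: flip.cases) simp

text \<open>
  The initial vertex of an arc is a copy of a germ that contains the arc's state; this is what
  makes both projections compatible with initial vertices.
\<close>

lemma cover_tail_cases:
  assumes "(e1, d, j) \<in> cover_arcs"
  obtains s i where "cover_tail (e1, d, j) = (tail X1 e1, s, i)" "s \<in> germs (tail X1 e1)"
    "(e1, d) \<in> s" "i < vert_mult (tail X1 e1)"
proof -
  have "slot e1 d j \<in> slots e1 d"
    using slot_bij[of e1 d] assms by (auto simp: cover_arcs_def bij_betw_def)
  then show ?thesis using that by (cases "slot e1 d j") (auto simp: slots_def cover_tail_def)
qed

lemma cover_tail_verts: "a \<in> cover_arcs \<Longrightarrow> cover_tail a \<in> verts cover"
proof -
  assume a: "a \<in> cover_arcs"
  obtain e1 d j where [simp]: "a = (e1, d, j)" by (rule prod_cases3)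
  have "e1 \<in> arcs X1" using a by (simp add: cover_arcs_def)
  then show ?thesis using cover_tail_cases[of e1 d j] a by force
qed

lemma ograph_cover: "is_ograph cover"
proof (rule is_ographI)
  fix a assume "a \<in> arcs cover"
  then have a: "a \<in> cover_arcs" "fst a \<in> arcs X1" by (auto simp: cover_arcs_def)
  show "tail cover a \<in> verts cover" using cover_tail_verts[OF a(1)] by simp
  show "head cover a \<in> verts cover" using cover_tail_verts[OF flip_arcs[OF a(1)]] by simp
  have "fst (flip a) \<noteq> fst a" using X1.arev_neq[of "fst a"] a(2) by simp
  then have "flip a \<noteq> a" by (rule contrapos_nn) (rule arg_cong)
  then show "bar cover a \<noteq> a" using a(1) by simp
  show "bar cover (bar cover a) = a" using a(1) by simp
  show "tail cover (bar cover a) = head cover a" using a(1) by simp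
qed simp

lemma finite_cover: "finite_ograph cover"
  using finite_X1 finite_germs finite_arc_states
  by (auto simp: finite_ograph_def cover_arcs_def)

lemma proj1_simps [simp]:
  "x \<in> verts cover \<Longrightarrow> vmap proj1 x = fst x" "a \<in> cover_arcs \<Longrightarrow> emap proj1 a = fst a"
  "x \<in> verts cover \<Longrightarrow> vmor proj1 x = Id C (vobj X1 (fst x))"
  "a \<in> cover_arcs \<Longrightarrow> emor proj1 a = Id C (eobj X1 (fst a))"
  by (simp_all only: proj1_def ograph_mor.simps gobj_mor.simps restrict_apply')

lemma proj2_simps [simp]:
  "a \<in> cover_arcs \<Longrightarrow> emap proj2 a = fst (fst (snd a))"
  "a \<in> cover_arcs \<Longrightarrow> emor proj2 a = snd (fst (snd a))"
  by (auto simp: proj2_def split: prod.splits)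

lemma proj2_vert:
  assumes "(v1, s, i) \<in> verts cover"
  obtains F v where "F \<in> \<Phi>" "v \<in> verts Xt" "vmap f1 v = v1" "germ F v = s"
    "vmap proj2 (v1, s, i) = vmap F v"
    "vmor proj2 (v1, s, i) = Comp C (vmor F v) (ginv (vmor f1 v))"
proof -
  have "s \<in> germs v1" using assms by simp
  then obtain F v where "rep v1 s = (F, v)" "F \<in> \<Phi>" "v \<in> verts Xt" "vmap f1 v = v1" "germ F v = s"
    by (rule rep)
  then show ?thesis using that assms by (simp add: proj2_def)
qed

lemma cover_arc_cases:
  assumes a: "(e1, d, j) \<in> cover_arcs"
  obtains F e where "F \<in> \<Phi>" "e \<in> arcs Xt" "emap f1 e = e1" "d = arc_state F e"
    "vmap proj1 (cover_tail (e1, d, j)) = vmap f1 (tail Xt e)"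
    "vmap proj2 (cover_tail (e1, d, j)) = vmap F (tail Xt e)"
    "vmor proj2 (cover_tail (e1, d, j)) = Comp C (vmor F (tail Xt e)) (ginv (vmor f1 (tail Xt e)))"
proof -
  obtain s i where s: "cover_tail (e1, d, j) = (tail X1 e1, s, i)" "(e1, d) \<in> s"
    using cover_tail_cases[OF a] by blast
  have x: "(tail X1 e1, s, i) \<in> verts cover" using cover_tail_verts[OF a] s by simp
  obtain F v where F: "F \<in> \<Phi>" "v \<in> verts Xt" "vmap f1 v = tail X1 e1" "germ F v = s"
    "vmap proj2 (tail X1 e1, s, i) = vmap F v"
    "vmor proj2 (tail X1 e1, s, i) = Comp C (vmor F v) (ginv (vmor f1 v))"
    by (rule proj2_vert[OF x])
  obtain e where "e \<in> arcs Xt" "tail Xt e = v" "e1 = emap f1 e" "d = arc_state F e"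
    using s(2) unfolding F(4)[symmetric] germ_def by (auto simp: star_iff)
  then show ?thesis
    using that[of F e] F proj1_simps(1)[OF x] unfolding s(1) by simp
qed

section \<open>The projections to the two given graphs of objects\<close>

lemma fst_cover_tail [simp]: "fst (cover_tail a) = tail X1 (fst a)"
  by (cases a) (simp add: cover_tail_def)

lemma cover_arcs_D:
  assumes "a \<in> cover_arcs"
  shows "fst a \<in> arcs X1" "fst (snd a) \<in> arc_states (fst a)" "fst (fst (snd a)) \<in> arcs X2"
  using assms arc_states_subset by (auto simp: cover_arcs_def)

lemma proj1_graph: "graph_morphism cover X1 proj1"
  unfolding graph_morphism_def
proof (intro conjI ballI)
  show "vmap proj1 \<in> verts cover \<rightarrow>\<^sub>E verts X1" by (auto simp: proj1_def)
  show "emap proj1 \<in> arcs cover \<rightarrow>\<^sub>E arcs X1"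
    using cover_arcs_D(1) by (auto simp: proj1_def)
  fix a assume "a \<in> arcs cover"
  then have a: "a \<in> cover_arcs" by simp
  note t = proj1_simps(1)[OF cover_tail_verts[OF a]]
    proj1_simps(1)[OF cover_tail_verts[OF flip_arcs[OF a]]]
  show "tail X1 (emap proj1 a) = vmap proj1 (tail cover a)"
    using a by (simp only: proj1_simps(2) cover_simps(3) t fst_cover_tail)
  show "head X1 (emap proj1 a) = vmap proj1 (head cover a)"
    using a cover_arcs_D(1)[OF a]
    by (simp only: proj1_simps(2) cover_simps(4) t fst_cover_tail fst_flip X1.tail_bar)
  show "bar X1 (emap proj1 a) = emap proj1 (bar cover a)"
    using a by (simp only: proj1_simps(2) cover_simps(5) flip_arcs fst_flip)
qed

lemma gobj_cover: "is_gobj C M2 cover"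
  by (rule pullback_gobj[OF ograph_cover gobj_X1 proj1_graph])
    (simp_all only: cover_simps(2,7-10) proj1_simps)

lemma proj1_morphism: "gobj_morphism C M1 cover X1 proj1"
proof (rule pullback_morphism[OF gobj_cover gobj_X1 proj1_graph])
  show "vmor proj1 = (\<lambda>x\<in>verts cover. Id C (vobj cover x))"
    by (simp only: proj1_def cover_simps(7) gobj_mor.simps)
  show "emor proj1 = (\<lambda>a\<in>arcs cover. Id C (eobj cover a))"
    by (simp only: proj1_def cover_simps(2,8) gobj_mor.simps)
qed (simp_all only: cover_simps(2,7-10) proj1_simps)

lemma cover_arc_cases':
  assumes a: "a \<in> cover_arcs"
  obtains F e where "F \<in> \<Phi>" "e \<in> arcs Xt" "emap proj1 a = emap f1 e"
    "emap proj2 a = emap F e" "emor proj2 a = Comp C (emor F e) (ginv (emor f1 e))"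
    "vmap proj1 (tail cover a) = vmap f1 (tail Xt e)"
    "vmap proj2 (tail cover a) = vmap F (tail Xt e)"
    "vmor proj2 (tail cover a) = Comp C (vmor F (tail Xt e)) (ginv (vmor f1 (tail Xt e)))"
proof -
  obtain e1 d j where aeq: "a = (e1, d, j)" by (rule prod_cases3)
  obtain F e where F: "F \<in> \<Phi>" "e \<in> arcs Xt" "emap f1 e = e1" "d = arc_state F e"
    "vmap proj1 (cover_tail (e1, d, j)) = vmap f1 (tail Xt e)"
    "vmap proj2 (cover_tail (e1, d, j)) = vmap F (tail Xt e)"
    "vmor proj2 (cover_tail (e1, d, j)) = Comp C (vmor F (tail Xt e)) (ginv (vmor f1 (tail Xt e)))"
    by (rule cover_arc_cases[OF a[unfolded aeq]])
  have "emap proj1 a = e1" "emap proj2 a = fst d" "emor proj2 a = snd d"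
    using proj1_simps(2)[OF a] proj2_simps[OF a] by (simp_all only: aeq fst_conv snd_conv)
  with F show ?thesis
    by (intro that[of F e]) (simp_all only: aeq cover_simps(3) arc_state_def fst_conv snd_conv)
qed

lemma proj2_tail:
  assumes "a \<in> cover_arcs"
  shows "vmap proj2 (cover_tail a) = tail X2 (emap proj2 a)"
  by (rule cover_arc_cases'[OF assms]) (simp only: \<Phi>_graph(3) cover_simps(3))

lemma proj2_vmor:
  assumes x: "x \<in> verts cover"
  shows "vmap proj2 x \<in> verts X2" "vmor proj2 x \<in> M1" "Dom C (vmor proj2 x) = vobj cover x"
    "Cod C (vmor proj2 x) = vobj X2 (vmap proj2 x)"
proof -
  obtain v1 s i where xeq: "x = (v1, s, i)" by (rule prod_cases3)
  obtain F v where F: "F \<in> \<Phi>" "v \<in> verts Xt" "vmap f1 v = v1" "germ F v = s"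
    "vmap proj2 (v1, s, i) = vmap F v"
    "vmor proj2 (v1, s, i) = Comp C (vmor F v) (ginv (vmor f1 v))"
    by (rule proj2_vert[OF x[unfolded xeq]])
  show "vmap proj2 x \<in> verts X2" "vmor proj2 x \<in> M1" "Dom C (vmor proj2 x) = vobj cover x"
    "Cod C (vmor proj2 x) = vobj X2 (vmap proj2 x)"
    unfolding xeq F(5,6) using F(1-3) by (simp_all add: \<Phi>_graph \<Phi>_simps f1_mor)
qed

lemma proj2_flip:
  assumes a: "a \<in> cover_arcs"
  shows "emap proj2 (flip a) = bar X2 (emap proj2 a)" "emor proj2 (flip a) = emor proj2 a"
proof -
  obtain e1 e2 m j where [simp]: "a = (e1, (e2, m), j)" by (rule flip.cases)
  show "emap proj2 (flip a) = bar X2 (emap proj2 a)" "emor proj2 (flip a) = emor proj2 a"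
    using proj2_simps[OF a] proj2_simps[OF flip_arcs[OF a]] by simp_all
qed

lemma proj2_graph: "graph_morphism cover X2 proj2"
  unfolding graph_morphism_def
proof (intro conjI ballI)
  show "vmap proj2 \<in> verts cover \<rightarrow>\<^sub>E verts X2"
    using proj2_vmor(1) by (auto simp: proj2_def PiE_def simp del: cover_simps(1))
  show "emap proj2 \<in> arcs cover \<rightarrow>\<^sub>E arcs X2"
    using cover_arcs_D(3) proj2_simps(1) by (auto simp: proj2_def PiE_def)
  fix a assume "a \<in> arcs cover"
  then have a: "a \<in> cover_arcs" by simp
  have e2: "emap proj2 a \<in> arcs X2" using a cover_arcs_D(3)[OF a] by simp
  show "tail X2 (emap proj2 a) = vmap proj2 (tail cover a)"
    using proj2_tail[OF a] by simp
  show "head X2 (emap proj2 a) = vmap proj2 (head cover a)"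
    by (simp only: cover_simps(4) proj2_tail[OF flip_arcs[OF a]] proj2_flip(1)[OF a]
        X2.tail_bar[OF e2])
  show "bar X2 (emap proj2 a) = emap proj2 (bar cover a)"
    by (simp only: cover_simps(5)[OF a] proj2_flip(1)[OF a])
qed

lemma proj2_morphism: "gobj_morphism C M1 cover X2 proj2"
proof (rule gobj_morphismI[OF gobj_cover gobj_X2 proj2_graph])
  show "vmor proj2 \<in> extensional (verts cover)" "emor proj2 \<in> extensional (arcs cover)"
    by (simp_all add: proj2_def)
  fix a assume "a \<in> arcs cover"
  then have a: "a \<in> cover_arcs" by simp
  show "emor proj2 (bar cover a) = emor proj2 a"
    by (simp only: cover_simps(5)[OF a] proj2_flip(2)[OF a])
  obtain F e where F: "F \<in> \<Phi>" and e: "e \<in> arcs Xt" and p1: "emap proj1 a = emap f1 e"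
    and p2: "emap proj2 a = emap F e" "emor proj2 a = Comp C (emor F e) (ginv (emor f1 e))"
    and p2t: "vmor proj2 (tail cover a) = Comp C (vmor F (tail Xt e)) (ginv (vmor f1 (tail Xt e)))"
    by (rule cover_arc_cases'[OF a])
  have fst_a: "fst a = emap f1 e" using p1 a by simp
  let ?v = "tail Xt e"
  note [simp] = is_gobjD(6-8)[OF gobj_Xt] is_gobjD(6-8)[OF gobj_X1] is_gobjD(6-8)[OF gobj_X2]
    \<Phi>_simps(1-6)[OF F] f1_mor(1-6) f1_graph(1-3) \<Phi>_graph(1-3)[OF F]
  note Fm = gobj_morphismD(9)[OF \<Phi>_mor[OF F] e] and f1m = gobj_morphismD(9)[OF f1(1) e]
  show "emor proj2 a \<in> M1 \<and> Dom C (emor proj2 a) = eobj cover a \<and>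
      Cod C (emor proj2 a) = eobj X2 (emap proj2 a)"
    unfolding p2 using e by (simp add: fst_a)
  have "Comp C (Comp C (vmor F ?v) (ginv (vmor f1 ?v))) (phi0 X1 (emap f1 e)) =
      Comp C (phi0 X2 (emap F e)) (Comp C (emor F e) (ginv (emor f1 e)))"
  proof (rule M1_right_cancel[where m = "emor f1 e"])
    \<comment> \<open>Composed with the morphism of \<open>f1\<close> at \<open>e\<close>, both sides become the structure morphism of
      the tree followed by \<open>F\<close>.\<close>
    have "Comp C (Comp C (Comp C (vmor F ?v) (ginv (vmor f1 ?v))) (phi0 X1 (emap f1 e))) (emor f1 e) =
        Comp C (Comp C (vmor F ?v) (ginv (vmor f1 ?v))) (Comp C (phi0 X1 (emap f1 e)) (emor f1 e))"
      using e by (subst Comp_assoc[symmetric]; simp)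
    also have "\<dots> = Comp C (Comp C (Comp C (vmor F ?v) (ginv (vmor f1 ?v))) (vmor f1 ?v)) (phi0 Xt e)"
      unfolding f1m[symmetric] using e by (subst Comp_assoc; simp)
    also have "\<dots> = Comp C (phi0 X2 (emap F e)) (emor F e)"
      using e Fm by simp
    also have "\<dots> = Comp C (phi0 X2 (emap F e)) (Comp C (Comp C (emor F e) (ginv (emor f1 e))) (emor f1 e))"
      using e by simp
    also have "\<dots> = Comp C (Comp C (phi0 X2 (emap F e)) (Comp C (emor F e) (ginv (emor f1 e)))) (emor f1 e)"
      using e by (subst Comp_assoc; simp)
    finally show "Comp C (Comp C (Comp C (vmor F ?v) (ginv (vmor f1 ?v))) (phi0 X1 (emap f1 e)))
        (emor f1 e) = \<dots>" .
  qed (use e in simp_all)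
  then show "Comp C (vmor proj2 (tail cover a)) (phi0 cover a) =
      Comp C (phi0 X2 (emap proj2 a)) (emor proj2 a)"
    by (simp only: p2t p2 cover_simps(9) fst_a)
next
  fix x assume "x \<in> verts cover"
  then show "vmor proj2 x \<in> M1 \<and> Dom C (vmor proj2 x) = vobj cover x \<and>
      Cod C (vmor proj2 x) = vobj X2 (vmap proj2 x)"
    using proj2_vmor by blast
qed

lemma cover_arc_state_in_germ:
  assumes a: "a \<in> cover_arcs" and x: "cover_tail a = (v1, s, i)"
  shows "(fst a, fst (snd a)) \<in> s"
proof -
  obtain e1 d j where aeq: "a = (e1, d, j)" by (rule prod_cases3)
  show ?thesis
    by (rule cover_tail_cases[OF a[unfolded aeq]]) (use x in \<open>simp add: aeq\<close>)
qed

lemma cover_arc_unique: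
  assumes a: "a \<in> cover_arcs" and b: "b \<in> cover_arcs" and tails: "cover_tail a = cover_tail b"
    and states: "fst a = fst b" "fst (snd a) = fst (snd b)"
  shows "a = b"
proof -
  obtain e1 d j where aeq: "a = (e1, d, j)" by (rule prod_cases3)
  obtain k where beq: "b = (e1, d, k)"
    using states by (cases b rule: prod_cases3) (simp add: aeq)
  have "e1 \<in> arcs X1" "d \<in> arc_states e1" "j < arc_mult e1" "k < arc_mult e1"
    using a b by (simp_all add: aeq beq cover_arcs_def)
  moreover have "slot e1 d j = slot e1 d k" using tails by (simp add: aeq beq cover_tail_def)
  ultimately have "j = k"
    using slot_bij[of e1 d] by (auto simp: bij_betw_def dest: inj_onD)
  then show ?thesis by (simp add: aeq beq)
qed

lemma cover_arc_exists:
  assumes x: "(v1, s, i) \<in> verts cover" and s: "(e1, d) \<in> s"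
  obtains a where "a \<in> cover_arcs" "cover_tail a = (v1, s, i)" "fst a = e1" "fst (snd a) = d"
proof -
  have x': "s \<in> germs v1" "i < vert_mult v1" using x by simp_all
  then obtain F v where F: "v \<in> verts Xt" "vmap f1 v = v1" "s = germ F v"
    by (auto simp: germs_def)
  then have e1: "e1 \<in> arcs X1" "tail X1 e1 = v1"
    using s by (auto simp: germ_def star_iff f1_graph)
  then have d: "d \<in> arc_states e1"
    using germ_has_unique_arc_state(2)[OF e1(1)] x'(1) s by blast
  have "(s, i) \<in> slots e1 d" using x' s e1 by (simp add: slots_def)
  then have "(s, i) \<in> slot e1 d ` {..<arc_mult e1}"
    using slot_bij[OF e1(1) d] by (simp only: bij_betw_def)
  then obtain j where j: "j < arc_mult e1" "slot e1 d j = (s, i)" by auto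
  show ?thesis
    by (rule that[of "(e1, d, j)"]) (use e1 d j in \<open>simp_all add: cover_arcs_def cover_tail_def\<close>)
qed

lemma cover_star_iff: "a \<in> star cover x \<longleftrightarrow> a \<in> cover_arcs \<and> cover_tail a = x"
  by (simp add: star_iff)

text \<open>
  A germ contains one state over each edge of the star, and by the choice of \<open>slot\<close> one copy of this
  state starts at the given copy of the germ.
\<close>

lemma proj1_locally_bijective: "locally_bijective cover X1 proj1"
  unfolding locally_bijective_def
proof
  fix x assume x: "x \<in> verts cover"
  obtain v1 s i where xeq: "x = (v1, s, i)" by (rule prod_cases3)
  have sg: "s \<in> germs v1" using x by (simp add: xeq)
  note pG = graph_morphismD[OF proj1_graph]
  have p1x: "vmap proj1 x = v1" using proj1_simps(1)[OF x] by (simp add: xeq)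
  show "bij_betw (emap proj1) (star cover x) (star X1 (vmap proj1 x))"
  proof (rule bij_betw_imageI)
    show "inj_on (emap proj1) (star cover x)"
    proof (rule inj_onI)
      fix a b assume "a \<in> star cover x" "b \<in> star cover x" and eq: "emap proj1 a = emap proj1 b"
      then have ab: "a \<in> cover_arcs" "cover_tail a = x" "b \<in> cover_arcs" "cover_tail b = x"
        by (simp_all only: cover_star_iff)
      have fst_eq: "fst a = fst b" using eq ab by simp
      have "tail X1 (fst a) = v1" using fst_cover_tail[of a] ab(2) xeq by simp
      then have "\<exists>!d. (fst a, d) \<in> s"
        using germ_has_unique_arc_state(1)[of "fst a" s] cover_arcs_D(1)[OF ab(1)] sg by simp
      moreover have "(fst a, fst (snd a)) \<in> s" "(fst a, fst (snd b)) \<in> s"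
        using cover_arc_state_in_germ[OF ab(1)] cover_arc_state_in_germ[OF ab(3)] ab(2,4)
        by (simp_all add: xeq fst_eq)
      ultimately have "fst (snd a) = fst (snd b)" by blast
      then show "a = b" using cover_arc_unique[OF ab(1,3) _ fst_eq] ab(2,4) by simp
    qed
    show "emap proj1 ` star cover x = star X1 (vmap proj1 x)"
    proof (intro equalityI subsetI)
      fix e1 assume "e1 \<in> emap proj1 ` star cover x"
      then obtain a where a: "a \<in> arcs cover" "tail cover a = x" "e1 = emap proj1 a"
        by (auto simp only: star_iff)
      then show "e1 \<in> star X1 (vmap proj1 x)"
        using pG(2,3)[OF a(1)] by (simp only: star_iff)
    next
      fix e1 assume "e1 \<in> star X1 (vmap proj1 x)"
      then have e1: "e1 \<in> arcs X1" "tail X1 e1 = v1" by (simp_all only: star_iff p1x)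
      obtain d where "(e1, d) \<in> s"
        using ex1_implies_ex[OF germ_has_unique_arc_state(1)[OF e1(1)]] sg e1(2) by blast
      then obtain a where a: "a \<in> cover_arcs" "cover_tail a = (v1, s, i)" "fst a = e1"
        using cover_arc_exists x xeq by metis
      then have "a \<in> star cover x" "emap proj1 a = e1"
        by (simp_all only: cover_star_iff xeq proj1_simps(2))
      then show "e1 \<in> emap proj1 ` star cover x" by blast
    qed
  qed
qed

text \<open>
  The germ at \<open>x\<close> comes from a covering \<open>F\<close> in \<open>\<Phi>\<close>, which is bijective on the star; so the states in
  the germ also correspond to the edges of \<open>X2\<close> at the image of \<open>x\<close>.
\<close>

lemma proj2_locally_bijective: "locally_bijective cover X2 proj2"
  unfolding locally_bijective_def
proof
  fix x assume x: "x \<in> verts cover"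
  obtain v1 s i where xeq: "x = (v1, s, i)" by (rule prod_cases3)
  note pG = graph_morphismD[OF proj2_graph]
  obtain F v where F: "F \<in> \<Phi>" "v \<in> verts Xt" "germ F v = s" "vmap proj2 (v1, s, i) = vmap F v"
    using proj2_vert x xeq by metis
  note F_bij = gobj_coveringD(2)[OF \<Phi>_covering[OF F(1)]]
  have arc: "\<exists>e\<in>arcs Xt. tail Xt e = v \<and> fst a = emap f1 e \<and> fst (snd a) = arc_state F e \<and>
      emap proj2 a = emap F e" if a: "a \<in> star cover x" for a
  proof -
    have a': "a \<in> cover_arcs" "cover_tail a = (v1, s, i)" using a by (simp_all only: cover_star_iff xeq)
    have "(fst a, fst (snd a)) \<in> germ F v" using cover_arc_state_in_germ[OF a'] F(3) by simp
    then show ?thesis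
      using proj2_simps(1)[OF a'(1)] by (auto simp: germ_def star_iff arc_state_def)
  qed
  show "bij_betw (emap proj2) (star cover x) (star X2 (vmap proj2 x))"
  proof (rule bij_betw_imageI)
    show "inj_on (emap proj2) (star cover x)"
    proof (rule inj_onI)
      fix a b assume a: "a \<in> star cover x" and b: "b \<in> star cover x"
        and eq: "emap proj2 a = emap proj2 b"
      obtain e where e: "e \<in> arcs Xt" "tail Xt e = v" "fst a = emap f1 e"
        "fst (snd a) = arc_state F e" "emap proj2 a = emap F e" using arc[OF a] by blast
      obtain e' where e': "e' \<in> arcs Xt" "tail Xt e' = v" "fst b = emap f1 e'"
        "fst (snd b) = arc_state F e'" "emap proj2 b = emap F e'" using arc[OF b] by blast
      have "e = e'"
        by (rule locally_bijective_inj[OF F_bij is_gobjD(1)[OF gobj_Xt] e(1) e'(1)])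
          (use e e' eq in simp_all)
      then show "a = b"
        using cover_arc_unique[of a b] a b e(3,4) e'(3,4) by (simp only: cover_star_iff)
    qed
    show "emap proj2 ` star cover x = star X2 (vmap proj2 x)"
    proof (intro equalityI subsetI)
      fix e2 assume "e2 \<in> emap proj2 ` star cover x"
      then obtain a where a: "a \<in> arcs cover" "tail cover a = x" "e2 = emap proj2 a"
        by (auto simp only: star_iff)
      then show "e2 \<in> star X2 (vmap proj2 x)"
        using pG(2,3)[OF a(1)] by (simp only: star_iff)
    next
      fix e2 assume "e2 \<in> star X2 (vmap proj2 x)"
      then have e2: "e2 \<in> arcs X2" "tail X2 e2 = vmap F v" by (simp_all only: star_iff xeq F(4))
      obtain e where e: "e \<in> arcs Xt" "tail Xt e = v" "emap F e = e2"
        by (rule locally_bijective_surj[OF F_bij F(2) e2])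
      have "(emap f1 e, arc_state F e) \<in> s" using mem_germ_iff[OF e(1)] e(2) F(3) by blast
      then obtain a where a: "a \<in> cover_arcs" "cover_tail a = (v1, s, i)"
        "fst (snd a) = arc_state F e"
        using cover_arc_exists x xeq by metis
      then have "a \<in> star cover x" "emap proj2 a = e2"
        by (simp_all only: cover_star_iff xeq proj2_simps(1) arc_state_def fst_conv e(3))
      then show "e2 \<in> emap proj2 ` star cover x" by blast
    qed
  qed
qed

text \<open>
  A vertex of the glued graph knows only one covering that realises its germ, and that at one vertex
  of the tree. A deck transformation of \<open>f1\<close> moves this vertex to any other lift.
\<close>

lemma proj2_local_vertex:
  assumes x: "x \<in> verts cover" and v: "v \<in> verts Xt" "vmap f1 v = vmap proj1 x"
  shows "\<exists>F\<in>\<Phi>. vmap F v = vmap proj2 x \<and> vmor F v = Comp C (vmor proj2 x) (vmor f1 v)"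
proof -
  obtain v1 s i where xeq: "x = (v1, s, i)" by (rule prod_cases3)
  obtain F w where F: "F \<in> \<Phi>" "w \<in> verts Xt" "vmap f1 w = v1"
    "vmap proj2 x = vmap F w" "vmor proj2 x = Comp C (vmor F w) (ginv (vmor f1 w))"
    using proj2_vert x xeq by metis
  have "vmap f1 v = vmap f1 w" using v(2) F(3) proj1_simps(1)[OF x] xeq by simp
  then obtain \<gamma> where \<gamma>: "\<gamma> \<in> H" "gobj_comp C Xt f1 \<gamma> = f1" "vmap \<gamma> v = w"
    by (rule deck_vertex[OF v(1) F(2)])
  note \<gamma>D = gobj_morphismD(2-4)[OF H_mor[OF \<gamma>(1)] v(1)]
  have "vmor f1 v = Comp C (vmor f1 w) (vmor \<gamma> v)"
    using arg_cong[OF \<gamma>(2), of "\<lambda>f. vmor f v"] v(1) \<gamma>(3) by simp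
  moreover have "Comp C (Comp C (vmor F w) (ginv (vmor f1 w))) (Comp C (vmor f1 w) (vmor \<gamma> v)) =
      Comp C (Comp C (Comp C (vmor F w) (ginv (vmor f1 w))) (vmor f1 w)) (vmor \<gamma> v)"
    by (rule Comp_assoc) (use F \<gamma>D \<gamma>(3) f1_mor(1-3) \<Phi>_simps(1-3)[OF F(1)] in simp_all)
  moreover have "\<dots> = Comp C (vmor F w) (vmor \<gamma> v)"
    using F \<gamma>D \<gamma>(3) by (simp add: f1_mor(1-3) \<Phi>_simps(1-3)[OF F(1)])
  ultimately have "vmor (gobj_comp C Xt F \<gamma>) v = Comp C (vmor proj2 x) (vmor f1 v)"
    using v(1) by (simp add: F(5) \<gamma>(3))
  moreover have "vmap (gobj_comp C Xt F \<gamma>) v = vmap proj2 x" using v(1) by (simp add: F(4) \<gamma>(3))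
  ultimately show ?thesis using \<Phi>_comp[OF F(1) \<gamma>(1)] by blast
qed

lemma proj2_local_arc:
  assumes a: "a \<in> arcs cover" and e: "e \<in> arcs Xt" "emap f1 e = emap proj1 a"
  shows "\<exists>F\<in>\<Phi>. emap F e = emap proj2 a \<and> emor F e = Comp C (emor proj2 a) (emor f1 e)"
proof -
  have a': "a \<in> cover_arcs" using a by simp
  have "fst (snd a) \<in> arc_states (emap f1 e)"
    using cover_arcs_D(2)[OF a'] proj1_simps(2)[OF a'] e(2) by simp
  then obtain F where F: "F \<in> \<Phi>" "fst (snd a) = arc_state F e"
    using arc_states_lift[OF e(1)] by auto
  have "emap proj2 a = emap F e" "emor proj2 a = Comp C (emor F e) (ginv (emor f1 e))"
    using proj2_simps[OF a'] F(2) by (simp_all add: arc_state_def)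
  moreover have "Comp C (Comp C (emor F e) (ginv (emor f1 e))) (emor f1 e) = emor F e"
    using e(1) by (simp add: f1_mor \<Phi>_simps[OF F(1)])
  ultimately show ?thesis using F(1) by (intro bexI[of _ F]) simp_all
qed

end

section \<open>Leighton's theorem for graphs of objects\<close>

context leighton_setting
begin

theorem common_finite_cover:
  "\<exists>(X :: (nat, nat, 'o, 'm) gobj) \<mu>1 \<mu>2 \<nu>1 \<nu>2 g.
    is_gobj C M2 X \<and> finite_ograph X \<and>
    gobj_covering C M1 X X1 \<mu>1 \<and> gobj_covering C M1 X X2 \<mu>2 \<and>
    gobj_covering C M1 Xt X \<nu>1 \<and> gobj_covering C M1 Xt X \<nu>2 \<and>
    g \<in> symmetry_closure C M1 Xt H \<and>
    f1 = gobj_comp C Xt \<mu>1 \<nu>1 \<and> f2 = gobj_comp C Xt \<mu>2 \<nu>2 \<and> \<nu>1 = gobj_comp C Xt \<nu>2 g"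
proof -
  obtain v0 where v0: "v0 \<in> verts Xt" using tree_nonempty[OF tree_Xt] by blast
  let ?v1 = "vmap f1 v0"
  obtain s where "s \<in> germs ?v1" using germs_nonempty[OF f1_graph(1)[OF v0]] by blast
  then have x0: "(?v1, s, 0) \<in> verts cover"
    using f1_graph(1)[OF v0] vert_mult(2)[OF f1_graph(1)[OF v0]] by simp
  \<comment> \<open>The lift of \<open>f1\<close> singles out one component of \<open>cover\<close>, which may be disconnected.\<close>
  obtain \<nu> where \<nu>: "gobj_morphism C M1 Xt cover \<nu>" "gobj_comp C Xt proj1 \<nu> = f1"
    "vmap \<nu> v0 = (?v1, s, 0)"
    by (rule gobj_lift[OF tree_Xt gobj_Xt gobj_cover gobj_X1 proj1_morphism proj1_locally_bijective
          f1(1) v0 x0]) (simp only: proj1_simps(1)[OF x0] fst_conv)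
  note \<nu>G = graph_morphismD[OF gobj_morphismD(1)[OF \<nu>(1)]]
  have \<nu>_bij: "locally_bijective Xt cover \<nu>"
    by (rule locally_bijective_comp_cancel[where C = C, OF ograph_cover gobj_morphismD(1)[OF \<nu>(1)] proj1_graph
          proj1_locally_bijective]) (simp only: \<nu>(2) f1(2))
  have "vmap \<nu> ` verts Xt \<subseteq> verts cover" using \<nu>G(1) by blast
  moreover have "head cover a \<in> vmap \<nu> ` verts Xt"
    if a: "a \<in> arcs cover" "tail cover a \<in> vmap \<nu> ` verts Xt" for a
  proof -
    obtain v where v: "v \<in> verts Xt" "tail cover a = vmap \<nu> v" using a(2) by blast
    obtain e where "e \<in> arcs Xt" "emap \<nu> e = a"
      by (rule locally_bijective_surj[OF \<nu>_bij v(1) a(1) v(2)])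
    then show ?thesis using \<nu>G(4) Xt.head_verts by blast
  qed
  ultimately obtain X :: "(nat, nat, 'o, 'm) gobj" and \<iota> where X: "is_gobj C M2 X" "finite_ograph X"
    and \<iota>: "gobj_morphism C M1 X cover \<iota>" "locally_bijective X cover \<iota>"
      "inj_on (vmap \<iota>) (verts X)" "vmap \<iota> ` verts X = vmap \<nu> ` verts Xt"
    by (rule finite_subgraph_copy[OF gobj_cover finite_cover])
  note \<iota>G = graph_morphismD[OF gobj_morphismD(1)[OF \<iota>(1)]]
  have "vmap \<nu> v0 \<in> vmap \<iota> ` verts X" unfolding \<iota>(4) using v0 by (rule imageI)
  then obtain y0 where y0: "y0 \<in> verts X" "vmap \<iota> y0 = vmap \<nu> v0" by (metis imageE)
  obtain \<nu>1 where \<nu>1: "gobj_morphism C M1 Xt X \<nu>1" "gobj_comp C Xt \<iota> \<nu>1 = \<nu>" "vmap \<nu>1 v0 = y0"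
    by (rule gobj_lift[OF tree_Xt gobj_Xt X(1) gobj_cover \<iota>(1,2) \<nu>(1) v0 y0])
  note \<nu>1G = graph_morphismD[OF gobj_morphismD(1)[OF \<nu>1(1)]]
  have \<nu>1_bij: "locally_bijective Xt X \<nu>1"
    by (rule locally_bijective_comp_cancel[where C = C, OF is_gobjD(1)[OF X(1)] gobj_morphismD(1)[OF \<nu>1(1)]
          gobj_morphismD(1)[OF \<iota>(1)] \<iota>(2)]) (simp only: \<nu>1(2) \<nu>_bij)
  have \<nu>_v: "vmap \<nu> v = vmap \<iota> (vmap \<nu>1 v)" if "v \<in> verts Xt" for v
    using arg_cong[OF \<nu>1(2), of "\<lambda>f. vmap f v"] that by simp
  have \<nu>1_surj: "verts X \<subseteq> vmap \<nu>1 ` verts Xt"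
  proof
    fix y assume y: "y \<in> verts X"
    then have "vmap \<iota> y \<in> vmap \<nu> ` verts Xt" by (simp only: \<iota>(4)[symmetric] imageI)
    then obtain v where v: "v \<in> verts Xt" "vmap \<iota> y = vmap \<nu> v" by blast
    then have "y = vmap \<nu>1 v"
      using \<nu>_v[OF v(1)] by (intro inj_onD[OF \<iota>(3) _ y \<nu>1G(1)[OF v(1)]]) simp
    then show "y \<in> vmap \<nu>1 ` verts Xt" using v(1) by blast
  qed
  have cover_\<nu>1: "gobj_covering C M1 Xt X \<nu>1"
    by (rule gobj_coveringI[OF X(1) \<nu>1(1) \<nu>1_bij \<nu>1_surj])
  define \<mu>1 where "\<mu>1 = gobj_comp C X proj1 \<iota>"
  define \<mu>2 where "\<mu>2 = gobj_comp C X proj2 \<iota>"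
  have \<mu>1: "gobj_morphism C M1 X X1 \<mu>1" "locally_bijective X X1 \<mu>1"
    unfolding \<mu>1_def
    by (rule gobj_comp_morphism[OF X(1) gobj_cover gobj_X1 \<iota>(1) proj1_morphism])
      (rule locally_bijective_comp[OF gobj_morphismD(1)[OF \<iota>(1)] \<iota>(2) proj1_locally_bijective])
  have \<mu>2: "gobj_morphism C M1 X X2 \<mu>2" "locally_bijective X X2 \<mu>2"
    unfolding \<mu>2_def
    by (rule gobj_comp_morphism[OF X(1) gobj_cover gobj_X2 \<iota>(1) proj2_morphism])
      (rule locally_bijective_comp[OF gobj_morphismD(1)[OF \<iota>(1)] \<iota>(2) proj2_locally_bijective])
  have \<mu>1\<nu>1: "gobj_comp C Xt \<mu>1 \<nu>1 = f1"
    unfolding \<mu>1_def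
    using gobj_comp_assoc[OF gobj_Xt X(1) gobj_cover gobj_X1 \<nu>1(1) \<iota>(1) proj1_morphism]
    by (simp only: \<nu>1(2) \<nu>(2))
  have \<mu>2\<nu>1: "gobj_comp C Xt \<mu>2 \<nu>1 = gobj_comp C Xt proj2 \<nu>"
    unfolding \<mu>2_def
    using gobj_comp_assoc[OF gobj_Xt X(1) gobj_cover gobj_X2 \<nu>1(1) \<iota>(1) proj2_morphism]
    by (simp only: \<nu>1(2))
  have "verts X1 \<subseteq> vmap \<mu>1 ` verts X"
  proof
    fix u assume "u \<in> verts X1"
    then obtain v where v: "v \<in> verts Xt" "vmap f1 v = u" by (rule vert_lift)
    then have "u = vmap \<mu>1 (vmap \<nu>1 v)" using arg_cong[OF \<mu>1\<nu>1, of "\<lambda>f. vmap f v"] v by simp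
    then show "u \<in> vmap \<mu>1 ` verts X" using \<nu>1G(1)[OF v(1)] by blast
  qed
  then have cover_\<mu>1: "gobj_covering C M1 X X1 \<mu>1" by (rule gobj_coveringI[OF gobj_X1 \<mu>1])
  have "vmap \<mu>2 y0 \<in> vmap f2 ` verts Xt"
    using graph_morphismD(1)[OF gobj_morphismD(1)[OF \<mu>2(1)] y0(1)] by (simp only: f2(3))
  then obtain w0 where w0: "w0 \<in> verts Xt" "vmap \<mu>2 y0 = vmap f2 w0" by blast
  obtain \<nu>2 where \<nu>2: "gobj_morphism C M1 Xt X \<nu>2" "gobj_comp C Xt \<mu>2 \<nu>2 = f2" "vmap \<nu>2 w0 = y0"
    by (rule gobj_lift[OF tree_Xt gobj_Xt X(1) gobj_X2 \<mu>2 f2(1) w0(1) y0(1) w0(2)])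
  note \<nu>2G = graph_morphismD[OF gobj_morphismD(1)[OF \<nu>2(1)]]
  have \<nu>2_bij: "locally_bijective Xt X \<nu>2"
    by (rule locally_bijective_comp_cancel[where C = C, OF is_gobjD(1)[OF X(1)] gobj_morphismD(1)[OF \<nu>2(1)]
          gobj_morphismD(1)[OF \<mu>2(1)] \<mu>2(2)]) (simp only: \<nu>2(2) f2(2))
  \<comment> \<open>The image of \<open>\<nu>2\<close> is closed under passing to neighbours, so it contains the image of \<open>\<nu>1\<close>.\<close>
  have \<nu>2_hits: "vmap \<nu>1 v \<in> vmap \<nu>2 ` verts Xt" if "v \<in> verts Xt" for v
    using tree_Xt v0 that
  proof (induction rule: Xt.tree_induct)
    case base
    show ?case using w0(1) \<nu>1(3) \<nu>2(3) by (intro image_eqI[of _ _ w0]) simp_all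
  next
    case (step e)
    then obtain w where w: "w \<in> verts Xt" "vmap \<nu>1 (tail Xt e) = vmap \<nu>2 w" by blast
    obtain e' where e': "e' \<in> arcs Xt" "emap \<nu>2 e' = emap \<nu>1 e"
      by (rule locally_bijective_surj[OF \<nu>2_bij w(1) \<nu>1G(2)[OF step(1)]])
        (simp only: \<nu>1G(3)[OF step(1)] w(2))
    have "vmap \<nu>1 (head Xt e) = vmap \<nu>2 (head Xt e')"
      using \<nu>1G(4)[OF step(1)] \<nu>2G(4)[OF e'(1)] e'(2) by simp
    then show ?case using Xt.head_verts[OF e'(1)] by blast
  qed
  have "verts X \<subseteq> vmap \<nu>2 ` verts Xt" using \<nu>1_surj \<nu>2_hits by blast
  then have cover_\<nu>2: "gobj_covering C M1 Xt X \<nu>2"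
    by (rule gobj_coveringI[OF X(1) \<nu>2(1) \<nu>2_bij])
  have "verts X2 \<subseteq> vmap \<mu>2 ` verts X"
  proof
    fix u assume "u \<in> verts X2"
    then have "u \<in> vmap f2 ` verts Xt" by (simp only: f2(3))
    then obtain v where v: "v \<in> verts Xt" "vmap f2 v = u" by blast
    then have "u = vmap \<mu>2 (vmap \<nu>2 v)" using arg_cong[OF \<nu>2(2), of "\<lambda>f. vmap f v"] v by simp
    then show "u \<in> vmap \<mu>2 ` verts X" using \<nu>2G(1)[OF v(1)] by blast
  qed
  then have cover_\<mu>2: "gobj_covering C M1 X X2 \<mu>2" by (rule gobj_coveringI[OF gobj_X2 \<mu>2])
  obtain g where g: "g \<in> carrier (Aut C M1 Xt)" "gobj_comp C Xt \<nu>2 g = \<nu>1" "vmap g v0 = w0"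
    by (rule covering_transport[OF tree_Xt gobj_Xt X(1) cover_\<nu>1 cover_\<nu>2 v0 w0(1)])
      (simp only: \<nu>1(3) \<nu>2(3))
  \<comment> \<open>Hence \<open>f2 g\<close> can be read off from the germs in \<open>cover\<close>, which come from members of \<open>\<Phi>\<close>.\<close>
  have f2g: "gobj_comp C Xt f2 g = gobj_comp C Xt proj2 \<nu>"
    using gobj_comp_assoc[OF gobj_Xt gobj_Xt X(1) gobj_X2 AutD(1)[OF g(1)] \<nu>2(1) \<mu>2(1)]
    by (simp only: g(2) \<nu>2(2) \<mu>2\<nu>1)
  note \<nu>D = gobj_morphismD(2-7)[OF \<nu>(1)]
  have "\<exists>h\<in>H. vmap g v = vmap h v \<and> vmor g v = vmor h v" if v: "v \<in> verts Xt" for v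
  proof -
    have x: "vmap \<nu> v \<in> verts cover" using v by (rule \<nu>G(1))
    have "vmap f1 v = vmap proj1 (vmap \<nu> v)"
      "vmor f1 v = Comp C (vmor proj1 (vmap \<nu> v)) (vmor \<nu> v)"
      using arg_cong[OF \<nu>(2), of "\<lambda>f. vmap f v"] arg_cong[OF \<nu>(2), of "\<lambda>f. vmor f v"]
      by (simp_all only: gobj_comp_simps(1,3)[OF v])
    \<comment> \<open>\<open>proj1\<close> is the identity on objects, so \<open>f1\<close> and \<open>\<nu>\<close> have the same morphism at \<open>v\<close>.\<close>
    moreover have "Comp C (vmor proj1 (vmap \<nu> v)) (vmor \<nu> v) = vmor \<nu> v"
      using Id_Comp[of "vmor \<nu> v"] \<nu>D(1-3)[OF v] cover_simps(7)
      by (simp only: proj1_simps(3)[OF x] M1_Mor)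
    ultimately obtain F where "F \<in> \<Phi>" "vmap F v = vmap proj2 (vmap \<nu> v)"
      "vmor F v = Comp C (vmor proj2 (vmap \<nu> v)) (vmor \<nu> v)"
      using proj2_local_vertex[OF x v] by metis
    moreover have "vmap proj2 (vmap \<nu> v) = vmap f2 (vmap g v)"
      "Comp C (vmor proj2 (vmap \<nu> v)) (vmor \<nu> v) = Comp C (vmor f2 (vmap g v)) (vmor g v)"
      using arg_cong[OF f2g, of "\<lambda>f. vmap f v"] arg_cong[OF f2g, of "\<lambda>f. vmor f v"]
      by (simp_all only: gobj_comp_simps(1,3)[OF v])
    ultimately show ?thesis using \<Phi>_local_vertex[OF g(1) _ v] by metis
  qed
  moreover have "\<exists>h\<in>H. emap g e = emap h e \<and> emor g e = emor h e" if e: "e \<in> arcs Xt" for e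
  proof -
    have a: "emap \<nu> e \<in> arcs cover" using e by (rule \<nu>G(2))
    then have a': "emap \<nu> e \<in> cover_arcs" by simp
    have "emap f1 e = emap proj1 (emap \<nu> e)"
      "emor f1 e = Comp C (emor proj1 (emap \<nu> e)) (emor \<nu> e)"
      using arg_cong[OF \<nu>(2), of "\<lambda>f. emap f e"] arg_cong[OF \<nu>(2), of "\<lambda>f. emor f e"]
      by (simp_all only: gobj_comp_simps(2,4)[OF e])
    moreover have "Comp C (emor proj1 (emap \<nu> e)) (emor \<nu> e) = emor \<nu> e"
      using Id_Comp[of "emor \<nu> e"] \<nu>D(4-6)[OF e] cover_simps(8)
      by (simp only: proj1_simps(4)[OF a'] M1_Mor)
    ultimately obtain F where "F \<in> \<Phi>" "emap F e = emap proj2 (emap \<nu> e)"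
      "emor F e = Comp C (emor proj2 (emap \<nu> e)) (emor \<nu> e)"
      using proj2_local_arc[OF a e] by metis
    moreover have "emap proj2 (emap \<nu> e) = emap f2 (emap g e)"
      "Comp C (emor proj2 (emap \<nu> e)) (emor \<nu> e) = Comp C (emor f2 (emap g e)) (emor g e)"
      using arg_cong[OF f2g, of "\<lambda>f. emap f e"] arg_cong[OF f2g, of "\<lambda>f. emor f e"]
      by (simp_all only: gobj_comp_simps(2,4)[OF e])
    ultimately show ?thesis using \<Phi>_local_arc[OF g(1) _ e] by metis
  qed
  ultimately have "g \<in> symmetry_closure C M1 Xt H"
    using g(1) unfolding symmetry_closure_def by blast
  then show ?thesis
    using X cover_\<mu>1 cover_\<mu>2 cover_\<nu>1 cover_\<nu>2
      \<mu>1\<nu>1[symmetric] \<nu>2(2)[symmetric] g(2)[symmetric]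
    by blast
qed

end

theorem theorem4p11:
  fixes C :: "('o, 'm) cat" and M1 M2 :: "'m set"
    and Xt :: "('v, 'e, 'o, 'm) gobj"
    and X1 :: "('v1, 'e1, 'o, 'm) gobj"
    and X2 :: "('v2, 'e2, 'o, 'm) gobj"
    and f1 :: "('v, 'e, 'v1, 'e1, 'm) gobj_mor"
    and f2 :: "('v, 'e, 'v2, 'e2, 'm) gobj_mor"
    and H :: "('v, 'e, 'v, 'e, 'm) gobj_mor set"
  assumes triple: "object_triple C M1 M2"
    and gobj_Xt: "is_gobj C M2 Xt"
    and gobj_X1: "is_gobj C M2 X1"
    and gobj_X2: "is_gobj C M2 X2"
    and cover_f1: "gobj_covering C M1 Xt X1 f1"
    and cover_f2: "gobj_covering C M1 Xt X2 f2"
    and finite_X1: "finite_ograph X1"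
    and finite_X2: "finite_ograph X2"
    and tree: "is_tree Xt"
    and subgroup_H: "subgroup H (Aut C M1 Xt)"
    and deck_f1: "deck_group C M1 Xt f1 \<subseteq> H"
    and deck_f2: "deck_group C M1 Xt f2 \<subseteq> H"
    and finite_isotropy: "finite_edge_isotropy Xt H"
  shows "\<exists>(X :: (nat, nat, 'o, 'm) gobj) \<mu>1 \<mu>2 \<nu>1 \<nu>2 g.
    is_gobj C M2 X \<and> finite_ograph X \<and>
    gobj_covering C M1 X X1 \<mu>1 \<and> gobj_covering C M1 X X2 \<mu>2 \<and>
    gobj_covering C M1 Xt X \<nu>1 \<and> gobj_covering C M1 Xt X \<nu>2 \<and>
    g \<in> symmetry_closure C M1 Xt H \<and>
    f1 = gobj_comp C Xt \<mu>1 \<nu>1 \<and>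
    f2 = gobj_comp C Xt \<mu>2 \<nu>2 \<and>
    \<nu>1 = gobj_comp C Xt \<nu>2 g"
proof -
  interpret leighton_setting C M1 M2 Xt X1 X2 f1 f2 H
    by (intro leighton_setting.intro leighton_setting_axioms.intro) fact+
  show ?thesis by (rule common_finite_cover)
qed

end
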